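(* Let $b\ge 2$ be an integer and let $P\subseteq\mathbb{R}^d$ be a tropical polytope all of whose vertices lie in $\mathbb{Z}_{\ge0}^d$. For every $i\in\{0,1,\dots,d\}$, the $i$-th tropical Ehrhart coefficient of $P$ is given by $$c_i^b(P)=\sum_{\substack{\Delta_\pi^s(a)\in\mathcal{T}_P\\ m=\dim(\Delta_\pi^s(a))\ge i}}(-1)^{m-i}(b-1)^i\,c_i\big(D_b^a\,\overline{\Delta_\pi^s(\mathbf{0})}\big),$$ where $\overline{Q}$ denotes the closure of $Q\subseteq\mathbb{R}^d$.
   Context: $\mathbb{T}=\mathbb{R}\cup\{-\infty\}$ with $x\oplus y=\max(x,y)$, $x\odot y=x+y$. For $V\subseteq\mathbb{T}^d$, $\mathrm{tconv}(V)=\{\bigoplus_{j=1}^n\lambda_j\odot v_j:\lambda_j\in\mathbb{T},\ \bigoplus_j\lambda_j=0,\ v_j\in V\}$. A tropical polytope is $\mathrm{tconv}(V)$ for a finite set $V$; its vertices are the elements of its unique minimal generating set. Tropical Ehrhart coefficients: $k\odot P=\{(k+x_1,\dots,k+x_d):x\in P\}$, $\Gamma_b^d=\{(\log_b x_1,\dots,\log_b x_d):x_l\in\mathbb{Z}_{\ge0}\}$ with $\log_b 0=-\infty$, and $\mathfrak{L}_P^b(k)=\#((k\odot P)\cap\Gamma_b^d)$. For $k\in\mathbb{Z}_{\ge0}$ this agrees with a polynomial in $b^k$, written $\mathfrak{L}_P^b(k)=\sum_{i=0}^d c_i^b(P)(b^k)^i$; the $c_i^b(P)$ are the tropical Ehrhart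 coefficients. Alcoved simplices: for a permutation $\pi\in S_d$, $a\in\mathbb{Z}^d$ and $s=(\prec_1,\dots,\prec_{d+1})\in\{=,\le,<\}^{d+1}$ let $\Delta_\pi^s(\mathbf{0})=\{x\in\mathbb{R}^d:0\prec_{d+1}x_{\pi(d)}\prec_d x_{\pi(d-1)}\prec_{d-1}\cdots\prec_2 x_{\pi(1)}\prec_1 1\}$ and $\Delta_\pi^s(a)=a+\Delta_\pi^s(\mathbf{0})$. The alcoved triangulation $\mathcal{T}_P$ of $P$ is the set of all relatively open simplices (i.e. nonempty $\Delta_\pi^s(a)$ with $s\in\{=,<\}^{d+1}$) contained in $P$; they partition $P$. Each of them can be written as $\Delta_\pi^s(a)$ with $a\in\mathbb{Z}_{\ge0}^d$, and in the sum each simplex occurs once, written with one such choice of $(\pi,s,a)$. $D_b^a=\mathrm{diag}(b^{a_1},\dots,b^{a_d})$. For a classical lattice polytope $Q\subseteq\mathbb{R}^d$ (vertices in $\mathbb{Z}^d$), $c_i(Q)$ denotes the coefficient of $k^i$ in its classical Ehrhart polynomial $\#(kQ\cap\mathbb{Z}^d)$. *)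

theory Defs
  imports "HOL-Analysis.Analysis" "HOL-Computational_Algebra.Polynomial"
begin

section \<open>Tropical polytopes\<close>

text \<open>
  The tropical numbers are the extended reals other than \<open>\<infinity>\<close>, with tropical addition
  \<open>max\<close> and tropical multiplication \<open>+\<close>. A finite tropical sum is a \<open>SUP\<close> over a finite
  index set; the empty tropical sum is \<open>-\<infinity>\<close>.
  The \<open>d\<close> coordinates are indexed by a finite type \<open>'n\<close>, so \<open>d\<close> is \<open>CARD('n)\<close>.
\<close>

definition tropical_space :: "(ereal ^ 'n) set" where
  "tropical_space = {x. \<forall>i. x $ i \<noteq> \<infinity>}"

text \<open>The inclusion of real vectors into tropical vectors.\<close>

definition tvec :: "real ^ 'n \<Rightarrow> ereal ^ 'n" where
  "tvec x = (\<chi> i. ereal (x $ i))"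

definition tconv :: "(ereal ^ 'n) set \<Rightarrow> (ereal ^ 'n) set" where
  "tconv V = {(\<chi> i. SUP j\<in>{1..n}. l j + v j $ i) | (n :: nat) (l :: nat \<Rightarrow> ereal) v.
     (\<forall>j\<in>{1..n}. l j \<noteq> \<infinity> \<and> v j \<in> V) \<and> (SUP j\<in>{1..n}. l j) = 0}"

definition tropical_polytope :: "(ereal ^ 'n) set \<Rightarrow> bool" where
  "tropical_polytope P \<longleftrightarrow> (\<exists>V. finite V \<and> V \<subseteq> tropical_space \<and> P = tconv V)"

definition minimal_generating_set :: "(ereal ^ 'n) set \<Rightarrow> (ereal ^ 'n) set \<Rightarrow> bool" where
  "minimal_generating_set P V \<longleftrightarrow>
     V \<subseteq> tropical_space \<and> tconv V = P \<and> (\<forall>W. W \<subset> V \<longrightarrow> tconv W \<noteq> P)"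

definition tropical_vertices :: "(ereal ^ 'n) set \<Rightarrow> (ereal ^ 'n) set" where
  "tropical_vertices P = (THE V. minimal_generating_set P V)"


section \<open>Tropical Ehrhart coefficients\<close>

definition tropical_scale :: "ereal \<Rightarrow> (ereal ^ 'n) set \<Rightarrow> (ereal ^ 'n) set" where
  "tropical_scale c P = (\<lambda>x. \<chi> i. c + x $ i) ` P"

definition tlog :: "nat \<Rightarrow> nat \<Rightarrow> ereal" where
  "tlog b z = (if z = 0 then -\<infinity> else ereal (log (real b) (real z)))"

definition log_lattice :: "nat \<Rightarrow> (ereal ^ 'n) set" where
  "log_lattice b = range (\<lambda>z :: nat ^ 'n. \<chi> i. tlog b (z $ i))"

definition tropical_count :: "nat \<Rightarrow> (ereal ^ 'n) set \<Rightarrow> nat \<Rightarrow> nat" where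
  "tropical_count b P k = card (tropical_scale (ereal (real k)) P \<inter> log_lattice b)"

definition tropical_ehrhart_poly :: "nat \<Rightarrow> (ereal ^ 'n) set \<Rightarrow> real poly" where
  "tropical_ehrhart_poly b P = (THE p. degree p \<le> CARD('n) \<and>
     (\<forall>k :: nat. real (tropical_count b P k) = poly p (real b ^ k)))"

definition tropical_ehrhart_coeff :: "nat \<Rightarrow> (ereal ^ 'n) set \<Rightarrow> nat \<Rightarrow> real" where
  "tropical_ehrhart_coeff b P i = coeff (tropical_ehrhart_poly b P) i"


section \<open>Classical Ehrhart coefficients\<close>

definition int_lattice :: "(real ^ 'n) set" where
  "int_lattice = {x. \<forall>i. x $ i \<in> \<int>}"

definition ehrhart_poly :: "(real ^ 'n) set \<Rightarrow> real poly" where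
  "ehrhart_poly Q = (THE p. \<forall>k :: nat. k \<ge> 1 \<longrightarrow>
     real (card ((\<lambda>x. real k *\<^sub>R x) ` Q \<inter> int_lattice)) = poly p (real k))"

definition ehrhart_coeff :: "(real ^ 'n) set \<Rightarrow> nat \<Rightarrow> real" where
  "ehrhart_coeff Q i = coeff (ehrhart_poly Q) i"


section \<open>Alcoved simplices\<close>

text \<open>
  Since the coordinates are indexed by the type \<open>'n\<close>, a permutation is an enumeration
  \<open>\<pi> 1, \<dots>, \<pi> d\<close> of \<open>'n\<close>. The sign vector \<open>s\<close> is given by the relations
  \<open>s 1, \<dots>, s (d + 1)\<close> themselves. Values of \<open>\<pi>\<close> and \<open>s\<close> at other arguments are irrelevant.
\<close>

definition is_perm :: "(nat \<Rightarrow> 'n::finite) \<Rightarrow> bool" where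
  "is_perm \<pi> \<longleftrightarrow> bij_betw \<pi> {1..CARD('n)} UNIV"

text \<open>
  \<open>alcove_chain \<pi> x\<close> lists the terms of \<open>1, x (\<pi> 1), \<dots>, x (\<pi> d), 0\<close> at positions
  \<open>0, 1, \<dots>, d, d + 1\<close>; the relation \<open>s j\<close> compares position \<open>j\<close> with position \<open>j - 1\<close>.
\<close>

definition alcove_chain :: "(nat \<Rightarrow> 'n::finite) \<Rightarrow> real ^ 'n \<Rightarrow> nat \<Rightarrow> real" where
  "alcove_chain \<pi> x j = (if j = 0 then 1 else if j \<le> CARD('n) then x $ \<pi> j else 0)"

definition alcoved_simplex ::
  "(nat \<Rightarrow> 'n::finite) \<Rightarrow> (nat \<Rightarrow> real \<Rightarrow> real \<Rightarrow> bool) \<Rightarrow> int ^ 'n \<Rightarrow> (real ^ 'n) set" where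
  "alcoved_simplex \<pi> s a =
     (\<lambda>x. (\<chi> i. real_of_int (a $ i)) + x) `
       {x. \<forall>j\<in>{1..CARD('n) + 1}. s j (alcove_chain \<pi> x j) (alcove_chain \<pi> x (j - 1))}"

definition open_signs :: "'n::finite itself \<Rightarrow> (nat \<Rightarrow> real \<Rightarrow> real \<Rightarrow> bool) set" where
  "open_signs _ = {s. \<forall>j\<in>{1..CARD('n) + 1}. s j \<in> {(=), (<)}}"

definition alcoved_triangulation :: "(real ^ 'n) set \<Rightarrow> (real ^ 'n) set set" where
  "alcoved_triangulation P =
     {alcoved_simplex \<pi> s a | \<pi> s a. is_perm \<pi> \<and> s \<in> open_signs TYPE('n) \<and>
        alcoved_simplex \<pi> s a \<noteq> {} \<and> alcoved_simplex \<pi> s a \<subseteq> P}"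

text \<open>
  The label \<open>(\<pi>, s, a)\<close> of a simplex is not unique. A labelling of the triangulation is
  a set of labels with nonnegative \<open>a\<close> that contains exactly one label for each simplex.
\<close>

definition triangulation_labelling ::
  "(real ^ 'n) set \<Rightarrow>
   ((nat \<Rightarrow> 'n::finite) \<times> (nat \<Rightarrow> real \<Rightarrow> real \<Rightarrow> bool) \<times> (int ^ 'n)) set \<Rightarrow> bool" where
  "triangulation_labelling P R \<longleftrightarrow>
     (\<forall>(\<pi>, s, a)\<in>R. is_perm \<pi> \<and> s \<in> open_signs TYPE('n) \<and> (\<forall>i. 0 \<le> a $ i)) \<and>
     bij_betw (\<lambda>(\<pi>, s, a). alcoved_simplex \<pi> s a) R (alcoved_triangulation P)"

definition diag_pow :: "nat \<Rightarrow> int ^ 'n \<Rightarrow> real ^ 'n ^ 'n" where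
  "diag_pow b a = (\<chi> i j. if i = j then real b powi (a $ i) else 0)"

end

(*
  A point x lies in the tropical hull of V iff every homogeneous coordinate p admits a v in V
  with x_p - x_q <= v_p - v_q for all q. For integral V this depends only on the open alcove of x,
  so P is the disjoint union of the cells of its alcoved triangulation.

  On one cell, with strict chain inequalities at m + 1 positions, the substitution
  z_i = b^(a_i) (b^k + y_i) makes the chain of logarithms a chain between 0 and (b - 1) b^k; it
  identifies the points of the logarithmic lattice with the interior lattice points of the
  (b - 1) b^k-fold dilate of the lattice simplex D_b^a closure(Delta). By Ehrhart-Macdonald
  reciprocity for lattice simplices their number is (-1)^m L(- (b - 1) b^k), and comparing
  coefficients of powers of b^k gives the formula.
*)
theory Submission
  imports Defs "HOL-Library.Multiset"
begin

text \<open>\<open>tropical_vertices\<close>, \<open>tropical_ehrhart_poly\<close> and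
  \<open>ehrhart_poly\<close> are definite descriptions. Integrality of the vertices becomes usable
  only after minimal generating sets are shown to be unique, and the polynomials are pinned down by
  their values at infinitely many points. Cells of all dimensions are treated alike through
  barycentric coordinates: a point of a dilate is the vector \<open>\<mu>\<close> of the m + 1
  positive gaps of its chain, and D_b^a only changes which \<open>\<mu>\<close> count as lattice
  points. These form a discrete group containing the integer vectors, which is all that reciprocity
  needs; its core is a reflection of the fundamental parallelepiped. The constant b - 1 is the
  length of the interval from 1 to b, the exponential image of the interval from 0 to 1. The simplex
  at the origin appears although the cell lies at a: for nonnegative a the shift by b^(a_i + k) is
  an integer, so it preserves the lattice, and only the scaling by b^(a_i) remains.\<close>

section \<open>Ehrhart reciprocity for simplices\<close>

lemma weak_compositions_eq_image:
  assumes "finite S"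
  shows "{n :: 'a \<Rightarrow> nat. (\<forall>j. j \<notin> S \<longrightarrow> n j = 0) \<and> sum n S = N} = count ` multisets_of_size S N"
proof (intro equalityI subsetI)
  fix n :: "'a \<Rightarrow> nat" assume n: "n \<in> {n. (\<forall>j. j \<notin> S \<longrightarrow> n j = 0) \<and> sum n S = N}"
  have fin: "finite {x. n x > 0}"
    by (rule finite_subset[OF _ assms]) (use n in auto)
  define X where "X = Abs_multiset n"
  have X: "count X = n"
    unfolding X_def using fin by simp
  have "set_mset X \<subseteq> S"
    using n by (auto simp: set_mset_def X)
  moreover have "size X = N"
  proof -
    have "size X = sum n (set_mset X)"
      by (simp add: size_multiset_overloaded_eq X)
    also have "\<dots> = sum n S"
      by (rule sum.mono_neutral_left) (use assms \<open>set_mset X \<subseteq> S\<close> in \<open>auto simp: set_mset_def X\<close>)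
    finally show ?thesis using n by simp
  qed
  ultimately show "n \<in> count ` multisets_of_size S N"
    using X by (auto simp: multisets_of_size_def)
next
  fix n assume "n \<in> count ` multisets_of_size S N"
  then obtain X where X: "n = count X" "set_mset X \<subseteq> S" "size X = N"
    by (auto simp: multisets_of_size_def)
  have "sum n S = sum n (set_mset X)"
    by (rule sum.mono_neutral_right) (use assms X in \<open>auto simp: not_in_iff\<close>)
  with X show "n \<in> {n. (\<forall>j. j \<notin> S \<longrightarrow> n j = 0) \<and> sum n S = N}"
    by (auto simp: size_multiset_overloaded_eq not_in_iff[symmetric])
qed

text \<open>Stars and bars, extended to negative totals: for \<open>- m \<le> r < 0\<close> there is
  no composition, and the binomial is \<open>q choose m\<close> with \<open>0 \<le> q < m\<close>,
  hence zero as well. The extension is needed because the fractional part of a lattice point may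
  overshoot the prescribed sum by up to \<open>m\<close>.\<close>

lemma card_weak_compositions:
  assumes "finite S" "card S = Suc m" "r \<in> \<int>" "r \<ge> - real m"
  shows "finite {n :: 'a \<Rightarrow> nat. (\<forall>j. j \<notin> S \<longrightarrow> n j = 0) \<and> real (sum n S) = r}" (is "finite ?A")
    and "real (card {n :: 'a \<Rightarrow> nat. (\<forall>j. j \<notin> S \<longrightarrow> n j = 0) \<and> real (sum n S) = r}) =
         (r + real m) gchoose m"
proof -
  have "finite ?A \<and> real (card ?A) = (r + real m) gchoose m"
  proof (cases "r \<ge> 0")
    case True
    with \<open>r \<in> \<int>\<close> obtain N where N: "r = real N"
      by (metis Ints_cases of_int_0_le_iff of_int_of_nat_eq zero_le_imp_eq_int)
    have A: "?A = count ` multisets_of_size S N"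
      unfolding N of_nat_eq_iff by (rule weak_compositions_eq_image[OF assms(1)])
    have "card ?A = (card S + N - 1) choose N"
      unfolding A by (subst card_image) (auto simp: inj_on_def count_inject card_multisets_of_size assms)
    also have "\<dots> = (N + m) choose m"
      using assms(2) by (subst binomial_symmetric) (auto simp: add.commute)
    finally have "real (card ?A) = (r + real m) gchoose m"
      by (simp add: binomial_gbinomial N)
    moreover have "finite ?A"
      unfolding A using finite_multisets_of_size[OF assms(1)] by blast
    ultimately show ?thesis by blast
  next
    case False
    then have "?A = {}" using of_nat_0_le_iff by blast
    obtain z :: int where z: "r = of_int z"
      using \<open>r \<in> \<int>\<close> Ints_cases by blast
    then obtain q where q: "r + real m = real q" "q < m"
      using assms(4) False by (intro that[of "nat (z + int m)"]) linarith+
    have "(r + real m) gchoose m = real (q choose m)"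
      by (simp add: q binomial_gbinomial)
    then show ?thesis
      unfolding \<open>?A = {}\<close> using q by (simp add: binomial_eq_0)
  qed
  then show "finite ?A" "real (card ?A) = (r + real m) gchoose m" by blast+
qed

text \<open>The cone over an \<open>m\<close>-simplex in coordinates along its vertices, which
  \<open>S\<close> indexes: the coordinate sum is the height, the integer vectors are generated by
  the vertices, and \<open>G\<close> is a lattice containing them. Discreteness enters as finiteness
  of the half-open fundamental parallelepiped.\<close>

locale gap_lattice =
  fixes S :: "'a set" and m :: nat and G :: "('a \<Rightarrow> real) set"
  assumes card_S: "card S = Suc m"
    and diff: "\<mu> \<in> G \<Longrightarrow> \<nu> \<in> G \<Longrightarrow> (\<lambda>j. \<mu> j - \<nu> j) \<in> G"
    and int_mem: "(\<And>j. j \<notin> S \<Longrightarrow> n j = 0) \<Longrightarrow> (\<lambda>j. of_int (n j)) \<in> G"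
    and sum_int: "\<mu> \<in> G \<Longrightarrow> sum \<mu> S \<in> \<int>"
    and finite_fractional: "finite {\<phi> \<in> G. \<forall>j\<in>S. 0 \<le> \<phi> j \<and> \<phi> j < 1}"
begin

lemma finite_S: "finite S"
  using card_S card.infinite by fastforce

lemma add_int_mem:
  assumes "\<mu> \<in> G" "\<And>j. j \<notin> S \<Longrightarrow> n j = 0"
  shows "(\<lambda>j. \<mu> j + of_int (n j)) \<in> G"
  using diff[OF assms(1) int_mem[of "\<lambda>j. - n j"]] assms(2) by simp

text \<open>
  With \<open>\<rho> = floor\<close> the set counted below is the closed dilated simplex; with
  \<open>\<rho> x = \<lceil>x\<rceil> - 1\<close> it is the open one. In both cases a lattice point is uniquely a point of
  the fundamental parallelepiped \<open>\<rho> = 0\<close> plus a vector of natural numbers.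
\<close>

lemma card_by_rounding:
  fixes \<rho> :: "real \<Rightarrow> int"
  assumes shift: "\<And>x n. \<rho> (x + of_int n) = \<rho> x + n"
    and fin: "finite {\<phi> \<in> G. \<forall>j\<in>S. \<rho> (\<phi> j) = 0}" (is "finite ?F")
    and bound: "\<And>\<phi>. \<phi> \<in> {\<phi> \<in> G. \<forall>j\<in>S. \<rho> (\<phi> j) = 0} \<Longrightarrow> sum \<phi> S \<le> real t + real m"
  shows "finite {\<mu> \<in> G. (\<forall>j\<in>S. \<rho> (\<mu> j) \<ge> 0) \<and> sum \<mu> S = real t}" (is "finite ?A")
    and "real (card {\<mu> \<in> G. (\<forall>j\<in>S. \<rho> (\<mu> j) \<ge> 0) \<and> sum \<mu> S = real t}) =
         (\<Sum>\<phi> | \<phi> \<in> G \<and> (\<forall>j\<in>S. \<rho> (\<phi> j) = 0). (real t - sum \<phi> S + real m) gchoose m)"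
proof -
  let ?B = "\<lambda>\<phi>. {n :: 'a \<Rightarrow> nat. (\<forall>j. j \<notin> S \<longrightarrow> n j = 0) \<and> real (sum n S) = real t - sum \<phi> S}"
  let ?f = "\<lambda>(\<phi>, n) j. \<phi> j + real (n j :: nat)"
  have B: "finite (?B \<phi>)" "real (card (?B \<phi>)) = (real t - sum \<phi> S + real m) gchoose m"
    if "\<phi> \<in> ?F" for \<phi>
  proof -
    have "real t - sum \<phi> S \<in> \<int>" "- real m \<le> real t - sum \<phi> S"
      using sum_int[of \<phi>] bound[OF that] that by auto
    then show "finite (?B \<phi>)" "real (card (?B \<phi>)) = (real t - sum \<phi> S + real m) gchoose m"
      using card_weak_compositions[OF finite_S card_S] by blast+
  qed
  have round_add: "\<rho> (x + real k) = \<rho> x + int k" for x k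
    using shift[of x "int k"] by simp
  \<comment> \<open>Rounding recovers \<open>n\<close>, since \<open>\<rho>\<close> vanishes on
    \<open>\<phi>\<close> and commutes with integer shifts.\<close>
  have inj: "inj_on ?f (Sigma ?F ?B)"
  proof (rule inj_onI, clarify)
    fix \<phi> n \<psi> n'
    assume \<phi>: "\<phi> \<in> G" "\<forall>j\<in>S. \<rho> (\<phi> j) = 0" and \<psi>: "\<psi> \<in> G" "\<forall>j\<in>S. \<rho> (\<psi> j) = 0"
      and n: "\<forall>j. j \<notin> S \<longrightarrow> n j = (0::nat)" and n': "\<forall>j. j \<notin> S \<longrightarrow> n' j = (0::nat)"
      and eq: "(\<lambda>j. \<phi> j + real (n j)) = (\<lambda>j. \<psi> j + real (n' j))"
    have "n j = n' j" for j
    proof (cases "j \<in> S")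
      case True
      then have "int (n j) = \<rho> (\<phi> j + real (n j))" "int (n' j) = \<rho> (\<psi> j + real (n' j))"
        using \<phi> \<psi> by (simp_all add: round_add)
      then show ?thesis using fun_cong[OF eq, of j] by simp
    qed (use n n' in auto)
    moreover from this have "\<phi> j = \<psi> j" for j
      using fun_cong[OF eq, of j] by simp
    ultimately show "\<phi> = \<psi> \<and> n = n'" by auto
  qed
  have image: "?f ` Sigma ?F ?B = ?A"
  proof (intro equalityI subsetI)
    fix \<mu> assume "\<mu> \<in> ?f ` Sigma ?F ?B"
    then obtain \<phi> n where \<mu>: "\<mu> = (\<lambda>j. \<phi> j + real (n j))" and \<phi>: "\<phi> \<in> ?F" and n: "n \<in> ?B \<phi>"
      by auto
    have "(\<lambda>j. \<phi> j + of_int (int (n j))) \<in> G"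
      by (rule add_int_mem) (use \<phi> n in auto)
    moreover have "sum \<mu> S = real t"
      using n by (simp add: \<mu> sum.distrib)
    ultimately show "\<mu> \<in> ?A"
      using \<phi> by (auto simp: \<mu> round_add)
  next
    fix \<mu> assume \<mu>: "\<mu> \<in> ?A"
    define n where "n j = (if j \<in> S then nat (\<rho> (\<mu> j)) else 0)" for j
    define \<phi> where "\<phi> j = \<mu> j + of_int (- int (n j))" for j
    have "(\<lambda>j. \<mu> j + of_int (- int (n j))) \<in> G"
      by (rule add_int_mem) (use \<mu> in \<open>auto simp: n_def\<close>)
    then have "\<phi> \<in> G"
      by (simp add: \<phi>_def[abs_def])
    moreover have "\<rho> (\<phi> j) = 0" if "j \<in> S" for j
      using that \<mu> by (simp add: \<phi>_def n_def shift del: of_int_minus)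
    ultimately have "\<phi> \<in> ?F" by simp
    moreover have "n \<in> ?B \<phi>"
      using \<mu> by (simp add: \<phi>_def sum.distrib sum_negf sum_subtractf) (simp add: n_def)
    moreover have "\<mu> = ?f (\<phi>, n)"
      by (simp add: \<phi>_def)
    ultimately show "\<mu> \<in> ?f ` Sigma ?F ?B" by blast
  qed
  show "finite ?A"
    unfolding image[symmetric] by (intro finite_imageI finite_SigmaI fin B(1))
  have "real (card ?A) = real (card (Sigma ?F ?B))"
    unfolding image[symmetric] card_image[OF inj] ..
  also have "\<dots> = real (\<Sum>\<phi>\<in>?F. card (?B \<phi>))"
    by (rule arg_cong[of _ _ real], rule card_SigmaI[OF fin], intro ballI, rule B(1))
  also have "\<dots> = (\<Sum>\<phi>\<in>?F. (real t - sum \<phi> S + real m) gchoose m)"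
    by (subst of_nat_sum, rule sum.cong[OF refl], rule B(2))
  finally show "real (card ?A) =
         (\<Sum>\<phi> | \<phi> \<in> G \<and> (\<forall>j\<in>S. \<rho> (\<phi> j) = 0). (real t - sum \<phi> S + real m) gchoose m)" .
qed

text \<open>Reflecting \<open>\<phi>\<close> to \<open>1 - \<phi>\<close> exchanges the boxes
  \<open>[0,1)\<close> and \<open>(0,1]\<close> and turns height \<open>h\<close> into
  \<open>m + 1 - h\<close>. Both counts are sums of binomials over these boxes, and
  \<open>(-x) gchoose m = (-1) ^ m * ((x + m - 1) gchoose m)\<close> matches them term by
  term.\<close>

lemma reciprocity:
  obtains p :: "real poly" where "degree p \<le> m"
    and "\<And>t :: nat. real (card {\<mu> \<in> G. (\<forall>j\<in>S. 0 \<le> \<mu> j) \<and> sum \<mu> S = real t}) = poly p (real t)"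
    and "\<And>t :: nat. t \<ge> 1 \<Longrightarrow> finite {\<mu> \<in> G. (\<forall>j\<in>S. 0 < \<mu> j) \<and> sum \<mu> S = real t}"
    and "\<And>t :: nat. t \<ge> 1 \<Longrightarrow> real (card {\<mu> \<in> G. (\<forall>j\<in>S. 0 < \<mu> j) \<and> sum \<mu> S = real t}) =
           (-1) ^ m * poly p (- real t)"
proof -
  define F where "F = {\<phi> \<in> G. \<forall>j\<in>S. 0 \<le> \<phi> j \<and> \<phi> j < 1}"
  define F' where "F' = {\<phi> \<in> G. \<forall>j\<in>S. 0 < \<phi> j \<and> \<phi> j \<le> 1}"
  \<comment> \<open>Each summand is \<open>(x - sum \<phi> S + real m) gchoose m\<close> as a
    polynomial in \<open>x\<close>.\<close>
  define p :: "real poly" where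
    "p = (\<Sum>\<phi>\<in>F. smult (1 / fact m) (\<Prod>i\<in>{0..<m}. [: real m - sum \<phi> S - real i, 1 :]))"
  have finF: "finite F"
    unfolding F_def by (rule finite_fractional)
  have poly_p: "poly p x = (\<Sum>\<phi>\<in>F. (x - sum \<phi> S + real m) gchoose m)" for x
    by (simp add: p_def poly_sum poly_prod gbinomial_prod_rev algebra_simps)
  have deg: "degree p \<le> m"
    unfolding p_def
  proof (rule degree_sum_le[OF finF])
    fix \<phi> assume "\<phi> \<in> F"
    have "degree (\<Prod>i\<in>{0..<m}. [: real m - sum \<phi> S - real i, 1 :]) \<le> m"
      using degree_prod_sum_le[of "{0..<m}" "\<lambda>i. [: real m - sum \<phi> S - real i, 1 :]"] by simp
    then show "degree (smult (1 / fact m) (\<Prod>i\<in>{0..<m}. [: real m - sum \<phi> S - real i, 1 :])) \<le> m"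
      using degree_smult_le order.trans by blast
  qed
  \<comment> \<open>Off \<open>S\<close> the integer vector is 0, as \<open>int_mem\<close> demands;
    the value \<open>- \<phi> j\<close> there still leaves \<open>r\<close> an involution.\<close>
  define r where "r \<phi> j = of_int (if j \<in> S then 1 else 0) - \<phi> j" for \<phi> :: "'a \<Rightarrow> real" and j
  have r_mem: "r \<phi> \<in> G" if "\<phi> \<in> G" for \<phi>
    unfolding r_def[abs_def] by (rule diff[OF int_mem that]) simp
  have r_r: "r (r \<phi>) = \<phi>" for \<phi>
    by (simp add: r_def[abs_def])
  have bij: "bij_betw r F F'"
    by (rule bij_betw_byWitness[where f' = r])
      (auto simp: F_def F'_def r_r r_mem, auto simp: r_def)
  have sum_r: "sum (r \<phi>) S = real m + 1 - sum \<phi> S" for \<phi>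
    using card_S by (simp add: r_def sum_subtractf)
  \<comment> \<open>The sum is below \<open>m + 1\<close> and integral, hence at most
    \<open>m\<close>, so the closed count holds even at \<open>t = 0\<close>.\<close>
  have F_bound: "sum \<phi> S \<le> real m" if "\<phi> \<in> F" for \<phi>
  proof -
    have "sum \<phi> S < sum (\<lambda>_. 1) S"
      by (rule sum_strict_mono) (use that finite_S card_S in \<open>auto simp: F_def\<close>)
    moreover have "\<phi> \<in> G" using that by (simp add: F_def)
    then obtain z where "sum \<phi> S = of_int z"
      by (meson sum_int Ints_cases)
    ultimately have "real_of_int z < real_of_int (1 + int m)" by (simp add: card_S)
    then have "z \<le> int m" unfolding of_int_less_iff by simp
    then show ?thesis using \<open>sum \<phi> S = of_int z\<close> by simp
  qed
  have floor_F: "{\<phi> \<in> G. \<forall>j\<in>S. \<lfloor>\<phi> j\<rfloor> = 0} = F"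
    by (auto simp: F_def floor_eq_iff)
  have ceil_F': "{\<phi> \<in> G. \<forall>j\<in>S. \<lceil>\<phi> j\<rceil> - 1 = 0} = F'"
    by (auto simp: F'_def ceiling_eq_iff)
  have closed: "real (card {\<mu> \<in> G. (\<forall>j\<in>S. 0 \<le> \<mu> j) \<and> sum \<mu> S = real t}) = poly p (real t)"
    for t :: nat
  proof -
    have "real (card {\<mu> \<in> G. (\<forall>j\<in>S. \<lfloor>\<mu> j\<rfloor> \<ge> 0) \<and> sum \<mu> S = real t}) =
        (\<Sum>\<phi> | \<phi> \<in> G \<and> (\<forall>j\<in>S. \<lfloor>\<phi> j\<rfloor> = 0). (real t - sum \<phi> S + real m) gchoose m)"
      by (rule card_by_rounding)
        (use finF in \<open>auto simp: floor_F intro: order.trans[OF F_bound]\<close>)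
    then show ?thesis
      unfolding floor_F poly_p by simp
  qed
  \<comment> \<open>The all-ones point of \<open>F'\<close> has sum \<open>m + 1\<close>, so this
    bound fails at \<open>t = 0\<close>.\<close>
  have F'_bound: "sum \<psi> S \<le> real t + real m" if "\<psi> \<in> F'" "t \<ge> 1" for \<psi> and t :: nat
  proof -
    have "sum \<psi> S \<le> sum (\<lambda>_. 1) S"
      by (rule sum_mono) (use that in \<open>auto simp: F'_def\<close>)
    with that card_S show ?thesis by simp
  qed
  have finF': "finite F'"
    using bij finF bij_betw_finite by blast
  have ceil_shift: "\<lceil>x + of_int n\<rceil> - 1 = \<lceil>x\<rceil> - 1 + n" for x :: real and n
    by simp
  have ceil_pos: "(0 \<le> \<lceil>x\<rceil> - 1) = (0 < x)" for x :: real
    by (simp add: int_one_le_iff_zero_less)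
  have op: "finite {\<mu> \<in> G. (\<forall>j\<in>S. 0 < \<mu> j) \<and> sum \<mu> S = real t}"
    "real (card {\<mu> \<in> G. (\<forall>j\<in>S. 0 < \<mu> j) \<and> sum \<mu> S = real t}) =
      (\<Sum>\<psi>\<in>F'. (real t - sum \<psi> S + real m) gchoose m)" if "t \<ge> 1" for t :: nat
    using card_by_rounding[of "\<lambda>x. \<lceil>x\<rceil> - 1" t, OF ceil_shift] finF' F'_bound[OF _ that]
    unfolding ceil_F' ceil_pos by blast+
  have "real (card {\<mu> \<in> G. (\<forall>j\<in>S. 0 < \<mu> j) \<and> sum \<mu> S = real t}) = (-1) ^ m * poly p (- real t)"
    if "t \<ge> 1" for t :: nat
  proof -
    have "(\<Sum>\<psi>\<in>F'. (real t - sum \<psi> S + real m) gchoose m) =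
        (\<Sum>\<phi>\<in>F. (real t + sum \<phi> S - 1) gchoose m)"
      by (subst sum.reindex_bij_betw[OF bij, symmetric]) (simp add: sum_r algebra_simps)
    also have "\<dots> = (\<Sum>\<phi>\<in>F. (-1) ^ m * ((- real t - sum \<phi> S + real m) gchoose m))"
    proof (rule sum.cong[OF refl])
      fix \<phi>
      have "- real t - sum \<phi> S + real m = - (real t + sum \<phi> S - real m)"
        by simp
      then have "(- real t - sum \<phi> S + real m) gchoose m =
          (-1) ^ m * ((real t + sum \<phi> S - 1) gchoose m)"
        using gbinomial_minus[of "real t + sum \<phi> S - real m" m] by (simp add: algebra_simps)
      then show "(real t + sum \<phi> S - 1) gchoose m =
          (-1) ^ m * ((- real t - sum \<phi> S + real m) gchoose m)"
        by (simp flip: mult.assoc power_mult_distrib)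
    qed
    finally show ?thesis
      using op(2)[OF that] by (simp add: poly_p sum_distrib_left)
  qed
  then show ?thesis
    using that deg closed op(1) by blast
qed

end

section \<open>Tropical hulls and vertices\<close>

text \<open>Homogeneous coordinates: the additional index \<open>None\<close> carries the coordinate \<open>0\<close>.\<close>

definition hom :: "real ^ 'n \<Rightarrow> 'n option \<Rightarrow> real" where
  "hom x p = (case p of None \<Rightarrow> 0 | Some i \<Rightarrow> x $ i)"

lemma hom_simps [simp]: "hom x None = 0" "hom x (Some i) = x $ i"
  by (simp_all add: hom_def)

text \<open>Tropical convex hull without coefficients: the inequality says that \<open>v\<close>
  with weight \<open>hom x p - hom v p\<close> stays below \<open>x\<close> and touches it at
  \<open>p\<close>. The case \<open>q = None\<close> makes every weight at most 0 and
  \<open>p = None\<close> makes one weight equal to 0, which is the normalization in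
  \<open>tconv\<close>.\<close>

definition real_hull :: "(real ^ 'n) set \<Rightarrow> (real ^ 'n) set" where
  "real_hull V = {x. \<forall>p. \<exists>v\<in>V. \<forall>q. hom x p - hom x q \<le> hom v p - hom v q}"

lemma subset_real_hull: "V \<subseteq> real_hull V"
  by (auto simp: real_hull_def)

lemma real_hull_mono: "V \<subseteq> W \<Longrightarrow> real_hull V \<subseteq> real_hull W"
  unfolding real_hull_def by blast

text \<open>For fixed \<open>p\<close> the defining relation between \<open>x\<close> and
  \<open>v\<close> is transitive, so \<open>real_hull\<close> is a closure operator.\<close>

lemma real_hull_subset:
  assumes "V \<subseteq> real_hull W"
  shows "real_hull V \<subseteq> real_hull W"
proof
  fix x assume x: "x \<in> real_hull V"
  have "\<exists>w\<in>W. \<forall>q. hom x p - hom x q \<le> hom w p - hom w q" for p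
  proof -
    obtain v where v: "v \<in> V" "\<forall>q. hom x p - hom x q \<le> hom v p - hom v q"
      using x by (auto simp: real_hull_def)
    then obtain w where "w \<in> W" "\<forall>q. hom v p - hom v q \<le> hom w p - hom w q"
      using assms by (fastforce simp: real_hull_def)
    with v show ?thesis by (meson order.trans)
  qed
  then show "x \<in> real_hull W" by (simp add: real_hull_def)
qed

lemma inj_tvec: "inj tvec"
  by (auto simp: inj_def tvec_def vec_eq_iff)

lemma SUP_attained:
  fixes f :: "'a \<Rightarrow> ereal"
  assumes "finite A" "A \<noteq> {}"
  shows "\<exists>j\<in>A. (SUP j\<in>A. f j) = f j"
proof -
  have "Max (f ` A) \<in> f ` A"
    by (rule Max_in) (use assms in auto)
  then obtain j where "j \<in> A" "Max (f ` A) = f j"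
    by blast
  moreover have "(SUP j\<in>A. f j) = Max (f ` A)"
    using assms by (simp add: Max_Sup)
  ultimately show ?thesis by metis
qed

text \<open>A term that attains the maximum in coordinate \<open>p\<close> is the witness for
  \<open>p\<close>; for \<open>p = None\<close> it is a term of weight 0.\<close>

lemma tconv_tvec_subset: "tconv (tvec ` V) \<subseteq> tvec ` real_hull (V :: (real ^ 'n) set)"
proof
  fix y assume "y \<in> tconv (tvec ` V)"
  then obtain n and l :: "nat \<Rightarrow> ereal" and v where
    y: "y = (\<chi> i. SUP j\<in>{1..n}. l j + v j $ i)"
    and lv: "\<And>j. j \<in> {1..n} \<Longrightarrow> l j \<noteq> \<infinity> \<and> v j \<in> tvec ` V"
    and l0: "(SUP j\<in>{1..n}. l j) = 0"
    by (auto simp: tconv_def)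
  have ne: "{1..n} \<noteq> {}"
    using l0 by (cases n) (auto simp: bot_ereal_def)
  have "\<forall>j\<in>{1..n}. \<exists>u\<in>V. v j = tvec u"
    using lv by (meson imageE)
  then obtain w where w: "\<And>j. j \<in> {1..n} \<Longrightarrow> w j \<in> V \<and> v j = tvec (w j)"
    by metis
  obtain j0 where j0: "j0 \<in> {1..n}" "l j0 = 0"
    using SUP_attained[of "{1..n}" l] ne l0 by auto
  have l_le: "l j \<le> 0" if "j \<in> {1..n}" for j
    using l0 that by (metis SUP_upper)
  have y_ge: "l j + ereal (w j $ i) \<le> y $ i" if "j \<in> {1..n}" for i j
    using SUP_upper[of j "{1..n}" "\<lambda>j. l j + v j $ i"] that w by (simp add: y tvec_def)
  have y_att: "\<exists>j\<in>{1..n}. y $ i = l j + ereal (w j $ i)" for i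
    using SUP_attained[of "{1..n}" "\<lambda>j. l j + v j $ i"] ne w by (auto simp: y tvec_def)
  \<comment> \<open>No term is \<open>\<infinity>\<close>, and the term of weight 0 keeps each
    maximum above \<open>-\<infinity>\<close>, although other weights may be
    \<open>-\<infinity>\<close>.\<close>
  have "\<bar>y $ i\<bar> \<noteq> \<infinity>" for i
  proof -
    obtain j where "j \<in> {1..n}" "y $ i = l j + ereal (w j $ i)"
      using y_att by blast
    then have "y $ i \<noteq> \<infinity>"
      using lv by auto
    moreover have "y $ i \<noteq> -\<infinity>"
      using y_ge[OF j0(1), of i] j0(2) by auto
    ultimately show ?thesis by (rule ereal_infinity_cases)
  qed
  then obtain x where x: "\<And>i. y $ i = ereal (x $ i)"
    using that[of "\<chi> i. real_of_ereal (y $ i)"] by (simp add: ereal_real)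
  have "x \<in> real_hull V"
    unfolding real_hull_def
  proof (intro CollectI allI)
    fix p
    have "\<exists>j\<in>{1..n}. l j = ereal (hom x p - hom (w j) p)"
    proof (cases p)
      case None
      then show ?thesis using j0 by (auto simp: zero_ereal_def)
    next
      case (Some i)
      obtain j where j: "j \<in> {1..n}" "y $ i = l j + ereal (w j $ i)"
        using y_att by blast
      then have "l j = ereal (x $ i - w j $ i)"
        using x[of i] by (cases "l j") auto
      then show ?thesis using j Some by auto
    qed
    then obtain j where j: "j \<in> {1..n}" "l j = ereal (hom x p - hom (w j) p)" by blast
    have "hom x p - hom x q \<le> hom (w j) p - hom (w j) q" for q
    proof (cases q)
      case None
      then show ?thesis using l_le[OF j(1)] j(2) by (simp add: zero_ereal_def)
    next
      case (Some i)
      then show ?thesis using y_ge[OF j(1), of i] j(2) x[of i] by simp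
    qed
    then show "\<exists>v\<in>V. \<forall>q. hom x p - hom x q \<le> hom v p - hom v q"
      using w j(1) by blast
  qed
  moreover have "y = tvec x"
    by (simp add: tvec_def vec_eq_iff x)
  ultimately show "y \<in> tvec ` real_hull V" by blast
qed

text \<open>Conversely, one generator \<open>w p\<close> for each of the \<open>d + 1\<close>
  homogeneous coordinates suffices, with weight \<open>hom x p - hom (w p) p\<close>: a tropical
  form of Caratheodory's theorem.\<close>

lemma tconv_tvec: "tconv (tvec ` V) = tvec ` real_hull (V :: (real ^ 'n) set)"
proof (rule equalityI[OF tconv_tvec_subset], clarify)
  fix x assume "x \<in> real_hull V"
  then have "\<forall>p. \<exists>v\<in>V. \<forall>q. hom x p - hom x q \<le> hom v p - hom v q"
    by (simp add: real_hull_def)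
  then obtain w where w: "\<And>p. w p \<in> V" "\<And>p q. hom x p - hom x q \<le> hom (w p) p - hom (w p) q"
    by metis
  define n where "n = card (UNIV :: 'n option set)"
  obtain h where h: "bij_betw h {1..n} (UNIV :: 'n option set)"
    unfolding n_def using ex_bij_betw_nat_finite_1[of "UNIV :: 'n option set"] by auto
  define l where "l j = ereal (hom x (h j) - hom (w (h j)) (h j))" for j
  define v where "v j = tvec (w (h j))" for j
  have reindex: "(SUP j\<in>{1..n}. f (h j)) = (SUP p. f p)" for f :: "'n option \<Rightarrow> ereal"
    using h by (simp add: bij_betw_def image_comp[symmetric, of f h, unfolded comp_def])
  have "(SUP j\<in>{1..n}. l j) = 0"
  proof -
    have "(SUP p. ereal (hom x p - hom (w p) p)) = 0"
    proof (rule SUP_eqI)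
      fix p show "ereal (hom x p - hom (w p) p) \<le> 0"
        using w(2)[of p None] by (simp add: zero_ereal_def)
    next
      fix u assume "\<And>p. p \<in> UNIV \<Longrightarrow> ereal (hom x p - hom (w p) p) \<le> u"
      from this[of None] show "0 \<le> u" by (simp add: zero_ereal_def)
    qed
    then show ?thesis unfolding l_def reindex[of "\<lambda>p. ereal (hom x p - hom (w p) p)"] .
  qed
  moreover have "(SUP j\<in>{1..n}. l j + v j $ i) = ereal (x $ i)" for i
  proof -
    have "(SUP p. ereal (hom x p - hom (w p) p + w p $ i)) = ereal (x $ i)"
    proof (rule SUP_eqI)
      fix p show "ereal (hom x p - hom (w p) p + w p $ i) \<le> ereal (x $ i)"
        using w(2)[of p "Some i"] by simp
    next
      fix u assume "\<And>p. p \<in> UNIV \<Longrightarrow> ereal (hom x p - hom (w p) p + w p $ i) \<le> u"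
      from this[of "Some i"] show "ereal (x $ i) \<le> u" by simp
    qed
    then show ?thesis
      unfolding l_def v_def tvec_def plus_ereal.simps vec_lambda_beta
        reindex[of "\<lambda>p. ereal (hom x p - hom (w p) p + w p $ i)"] .
  qed
  ultimately show "tvec x \<in> tconv (tvec ` V)"
    unfolding tconv_def
    by (intro CollectI exI[of _ n] exI[of _ l] exI[of _ v])
      (auto simp: l_def v_def tvec_def[of x] w(1))
qed

section \<open>Minimal generating sets and their uniqueness\<close>

lemma tvec_in_tropical_space: "tvec x \<in> tropical_space"
  by (simp add: tvec_def tropical_space_def)

lemma tconv_superset: "V \<subseteq> tconv V"
proof
  fix v assume "v \<in> V"
  then show "v \<in> tconv V"
    unfolding tconv_def
    by (intro CollectI exI[of _ 1] exI[of _ "\<lambda>_. 0"] exI[of _ "\<lambda>_. v"]) (auto simp: vec_eq_iff)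
qed

lemma minimal_generating_set_tvec:
  "minimal_generating_set (tvec ` P) (tvec ` E) \<longleftrightarrow>
     real_hull E = P \<and> (\<forall>W. W \<subset> E \<longrightarrow> real_hull W \<noteq> P)" for P E :: "(real ^ 'n) set"
proof -
  have *: "tconv (tvec ` W) = tvec ` P \<longleftrightarrow> real_hull W = P" for W :: "(real ^ 'n) set"
    by (simp add: tconv_tvec inj_image_eq_iff[OF inj_tvec])
  have "(\<forall>W. W \<subset> tvec ` E \<longrightarrow> tconv W \<noteq> tvec ` P) \<longleftrightarrow> (\<forall>W. W \<subset> E \<longrightarrow> tconv (tvec ` W) \<noteq> tvec ` P)"
  proof (intro iffI allI impI)
    fix W :: "(real ^ 'n) set"
    assume "\<forall>W. W \<subset> tvec ` E \<longrightarrow> tconv W \<noteq> tvec ` P" "W \<subset> E"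
    then show "tconv (tvec ` W) \<noteq> tvec ` P"
      using inj_tvec by (metis image_strict_mono inj_on_subset subset_UNIV)
  next
    fix W assume a: "\<forall>W. W \<subset> E \<longrightarrow> tconv (tvec ` W) \<noteq> tvec ` P" "W \<subset> tvec ` E"
    then obtain W' where "W = tvec ` W'" "W' \<subseteq> E"
      by (meson psubset_imp_subset subset_imageE)
    with a show "tconv W \<noteq> tvec ` P" by blast
  qed
  then show ?thesis
    unfolding minimal_generating_set_def * using tvec_in_tropical_space by auto
qed

text \<open>If \<open>v \<in> E\<close> is not in \<open>E'\<close>, then at each \<open>p\<close>
  it is dominated by some \<open>w \<in> E'\<close>, which is dominated by some
  \<open>u \<in> E\<close>. Were \<open>u = v\<close>, both dominations would be equalities and
  \<open>w = v\<close>. So \<open>v\<close> lies in the hull of \<open>E - {v}\<close>, against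
  minimality.\<close>

lemma minimal_generating_sets_eq:
  fixes E E' :: "(real ^ 'n) set"
  assumes "real_hull E = P" "\<And>W. W \<subset> E \<Longrightarrow> real_hull W \<noteq> P"
    and "real_hull E' = P" "\<And>W. W \<subset> E' \<Longrightarrow> real_hull W \<noteq> P"
  shows "E = E'"
proof -
  have "E \<subseteq> E'"
  proof
    fix v assume "v \<in> E"
    show "v \<in> E'"
    proof (rule ccontr)
      assume "v \<notin> E'"
      have "\<exists>u\<in>E - {v}. \<forall>q. hom v p - hom v q \<le> hom u p - hom u q" for p
      proof -
        have "v \<in> real_hull E'"
          using \<open>v \<in> E\<close> assms(1,3) subset_real_hull by blast
        then obtain w where w: "w \<in> E'" "\<forall>q. hom v p - hom v q \<le> hom w p - hom w q"
          by (auto simp: real_hull_def)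
        have "w \<in> real_hull E"
          using w(1) assms(1,3) subset_real_hull by blast
        then obtain u where u: "u \<in> E" "\<forall>q. hom w p - hom w q \<le> hom u p - hom u q"
          by (auto simp: real_hull_def)
        have "u \<noteq> v"
        proof
          assume "u = v"
          with u w have eq: "hom v p - hom v q = hom w p - hom w q" for q
            by (meson order.antisym)
          from eq[of None] have "hom v p = hom w p" by simp
          with eq[of "Some i" for i] have "v = w" by (simp add: vec_eq_iff)
          with w \<open>v \<notin> E'\<close> show False by simp
        qed
        with u w show ?thesis by (meson DiffI order.trans singletonD)
      qed
      then have "v \<in> real_hull (E - {v})" by (simp add: real_hull_def)
      then have "E \<subseteq> real_hull (E - {v})" using subset_real_hull[of "E - {v}"] by blast
      then have "real_hull (E - {v}) = P"
        using real_hull_subset[of E "E - {v}"] real_hull_mono[of "E - {v}" E] assms(1) by blast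
      with assms(2)[of "E - {v}"] \<open>v \<in> E\<close> show False by blast
    qed
  qed
  then show ?thesis using assms(1,4) by (metis psubsetI)
qed

text \<open>Generators belong to the polytope and are therefore real. Finiteness of
  \<open>V'\<close> yields an inclusion-minimal generating subset, and uniqueness makes the
  description in \<open>tropical_vertices\<close> denote it.\<close>

lemma tropical_vertices_real:
  fixes P :: "(real ^ 'n) set"
  assumes "tropical_polytope (tvec ` P)"
  obtains E where "finite E" "tropical_vertices (tvec ` P) = tvec ` E" "real_hull E = P"
proof -
  obtain V where V: "finite V" "tvec ` P = tconv V"
    using assms by (auto simp: tropical_polytope_def)
  then obtain V' where "V = tvec ` V'"
    using tconv_superset[of V] by (metis subset_imageE)
  then have V': "finite V'" "real_hull V' = P"
    using V by (auto simp: finite_image_iff inj_on_subset[OF inj_tvec] tconv_tvec inj_image_eq_iff[OF inj_tvec])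
  define \<E> where "\<E> = {E. E \<subseteq> V' \<and> real_hull E = P}"
  have "finite \<E>" "V' \<in> \<E>"
    using V' by (auto simp: \<E>_def)
  then obtain E where "E \<in> \<E>" and min: "\<And>W. W \<in> \<E> \<Longrightarrow> W \<subseteq> E \<Longrightarrow> E = W"
    by (meson finite_has_minimal2)
  then have E: "E \<subseteq> V'" "real_hull E = P" "\<And>W. W \<subset> E \<Longrightarrow> real_hull W \<noteq> P"
    by (auto simp: \<E>_def)
  have "minimal_generating_set (tvec ` P) (tvec ` E)"
    using E by (simp add: minimal_generating_set_tvec)
  moreover have "U = tvec ` E" if U: "minimal_generating_set (tvec ` P) U" for U
  proof -
    have "U \<subseteq> tvec ` P"
      using U tconv_superset[of U] by (auto simp: minimal_generating_set_def)
    then obtain E' where E': "U = tvec ` E'"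
      by (meson subset_imageE)
    then have "E' = E"
      using U E by (intro minimal_generating_sets_eq[of E' P E]) (auto simp: minimal_generating_set_tvec)
    with E' show ?thesis by simp
  qed
  ultimately have "tropical_vertices (tvec ` P) = tvec ` E"
    unfolding tropical_vertices_def by (rule the_equality)
  then show ?thesis
    by (rule that[OF finite_subset[OF E(1) V'(1)] _ E(2)])
qed

section \<open>Alcoves\<close>

text \<open>The classes are the relatively open faces of the affine braid arrangement, with
  hyperplanes \<open>x_p - x_q = c\<close>. Exchanging \<open>p\<close> and \<open>q\<close> gives
  the reverse inequality, so \<open>\<le>\<close> alone separates \<open><\<close>, \<open>=\<close>
  and \<open>>\<close>.\<close>

definition same_alcove :: "real ^ 'n \<Rightarrow> real ^ 'n \<Rightarrow> bool" where
  "same_alcove x y \<longleftrightarrow>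
     (\<forall>p q (c :: int). hom x p - hom x q \<le> of_int c \<longleftrightarrow> hom y p - hom y q \<le> of_int c)"

lemma same_alcove_refl: "same_alcove x x"
  and same_alcove_sym: "same_alcove x y \<Longrightarrow> same_alcove y x"
  and same_alcove_trans: "same_alcove x y \<Longrightarrow> same_alcove y z \<Longrightarrow> same_alcove x z"
  by (simp_all add: same_alcove_def)

lemma real_hull_same_alcove:
  assumes "\<And>v j. v \<in> E \<Longrightarrow> v $ j \<in> \<int>" "x \<in> real_hull E" "same_alcove x y"
  shows "y \<in> real_hull E"
proof -
  have "\<exists>v\<in>E. \<forall>q. hom y p - hom y q \<le> hom v p - hom v q" for p
  proof -
    obtain v where v: "v \<in> E" "\<forall>q. hom x p - hom x q \<le> hom v p - hom v q"
      using assms(2) by (auto simp: real_hull_def)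
    have "hom v q \<in> \<int>" for q
      using assms(1)[OF v(1)] by (cases q) auto
    then have "\<exists>c. hom v p - hom v q = of_int c" for q
      by (meson Ints_cases Ints_diff)
    with v assms(3) show ?thesis by (metis same_alcove_def)
  qed
  then show ?thesis by (simp add: real_hull_def)
qed

text \<open>The right-hand side does not mention \<open>c\<close>: any two chains with the same
  signs order their terms in the same way. A chain descends, with equality exactly along runs of
  \<open>(=)\<close>.\<close>

lemma signed_chain_le_iff:
  fixes c :: "nat \<Rightarrow> real"
  assumes s: "\<forall>j\<in>{1..N}. s j \<in> {(=), (<)}" and c: "\<forall>j\<in>{1..N}. s j (c j) (c (j - 1))"
    and "p \<le> N" "q \<le> N"
  shows "c p \<le> c q \<longleftrightarrow> q \<le> p \<or> (\<forall>j\<in>{p<..q}. s j = (=))"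
proof -
  have neq: "(<) \<noteq> ((=) :: real \<Rightarrow> real \<Rightarrow> bool)"
    by (metis less_irrefl)
  have "c q \<le> c p \<and> (c q = c p \<longleftrightarrow> (\<forall>j\<in>{p<..q}. s j = (=)))" if "p \<le> q" "q \<le> N" for p q
    using that
  proof (induction rule: dec_induct)
    case base
    show ?case by simp
  next
    case (step k)
    have "s (Suc k) \<in> {(=), (<)}" "s (Suc k) (c (Suc k)) (c k)"
      using s c[rule_format, of "Suc k"] step.prems by auto
    moreover have "{p<..Suc k} = insert (Suc k) {p<..k}"
      using step.hyps by auto
    ultimately show ?case
      using step neq by auto
  qed
  from this[of p q] this[of q p] assms(3,4) show ?thesis
    by (cases "q \<le> p") auto
qed

lemma mem_alcoved_simplex_iff:
  "x \<in> alcoved_simplex \<pi> s a \<longleftrightarrow>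
     (\<forall>j\<in>{1..CARD('n) + 1}. s j (alcove_chain \<pi> (x - (\<chi> i. real_of_int (a $ i))) j)
        (alcove_chain \<pi> (x - (\<chi> i. real_of_int (a $ i))) (j - 1)))"
  for \<pi> :: "nat \<Rightarrow> 'n::finite"
proof -
  let ?a = "\<chi> i. real_of_int (a $ i)"
  have "x \<in> (+) ?a ` A \<longleftrightarrow> x - ?a \<in> A" for A
    by (metis (no_types, lifting) add_diff_cancel_left' diff_add_cancel add.commute image_iff)
  then show ?thesis
    unfolding alcoved_simplex_def by simp
qed

text \<open>Together with \<open>alcove_offset\<close> this writes each chain term as a homogeneous
  coordinate minus an integer. Both constant ends belong to \<open>None\<close>; the first has
  offset -1 because it equals \<open>1 = 0 - (-1)\<close>.\<close>

definition alcove_index :: "(nat \<Rightarrow> 'n::finite) \<Rightarrow> nat \<Rightarrow> 'n option" where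
  "alcove_index \<pi> j = (if 1 \<le> j \<and> j \<le> CARD('n) then Some (\<pi> j) else None)"

definition alcove_offset :: "(nat \<Rightarrow> 'n::finite) \<Rightarrow> int ^ 'n \<Rightarrow> nat \<Rightarrow> int" where
  "alcove_offset \<pi> a j = (if j = 0 then -1 else if j \<le> CARD('n) then a $ \<pi> j else 0)"

lemma alcove_chain_eq:
  "alcove_chain \<pi> (x - (\<chi> i. real_of_int (a $ i))) j = hom x (alcove_index \<pi> j) - of_int (alcove_offset \<pi> a j)"
  by (auto simp: alcove_chain_def alcove_index_def alcove_offset_def)

lemma alcove_index_surj:
  fixes \<pi> :: "nat \<Rightarrow> 'n::finite"
  assumes "is_perm \<pi>"
  obtains j where "j \<in> {1..CARD('n) + 1}" "alcove_index \<pi> j = p"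
proof (cases p)
  case None
  then show ?thesis by (intro that[of "CARD('n) + 1"]) (auto simp: alcove_index_def)
next
  case (Some i)
  have "i \<in> \<pi> ` {1..CARD('n)}"
    using assms by (simp add: is_perm_def bij_betw_def)
  then obtain j where "j \<in> {1..CARD('n)}" "i = \<pi> j" by blast
  then show ?thesis using Some by (intro that[of j]) (auto simp: alcove_index_def)
qed

text \<open>Up to an integer, differences of homogeneous coordinates are differences of chain terms.
  Comparing them with integers thus amounts to ordering chain terms, which the signs determine;
  conversely, each sign is decided by such comparisons.\<close>

lemma alcoved_simplex_eq_class:
  fixes \<pi> :: "nat \<Rightarrow> 'n::finite"
  assumes \<pi>: "is_perm \<pi>" and s: "s \<in> open_signs TYPE('n)" and x: "x \<in> alcoved_simplex \<pi> s a"
  shows "alcoved_simplex \<pi> s a = {y. same_alcove x y}"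
proof -
  define ch where "ch y = alcove_chain \<pi> (y - (\<chi> i. real_of_int (a $ i)))" for y
  let ?N = "CARD('n) + 1"
  have mem: "y \<in> alcoved_simplex \<pi> s a \<longleftrightarrow> (\<forall>j\<in>{1..?N}. s j (ch y j) (ch y (j - 1)))" for y
    by (simp add: mem_alcoved_simplex_iff ch_def)
  have s': "\<forall>j\<in>{1..?N}. s j \<in> {(=), (<)}"
    using s by (simp add: open_signs_def)
  have ends: "ch y 0 = 1" "ch y ?N = 0" for y
    by (simp_all add: ch_def alcove_chain_def)
  have hom_ch: "hom y (alcove_index \<pi> j) = ch y j + of_int (alcove_offset \<pi> a j)" for y j
    by (simp add: ch_def alcove_chain_eq)
  have "same_alcove x y" if y: "y \<in> alcoved_simplex \<pi> s a" for y
  proof -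
    have le_iff: "ch x p \<le> ch x q \<longleftrightarrow> ch y p \<le> ch y q" if "p \<le> ?N" "q \<le> ?N" for p q
      using signed_chain_le_iff[OF s' _ that, of "ch x"] signed_chain_le_iff[OF s' _ that, of "ch y"] x y
      by (simp add: mem)
    have bounds: "0 \<le> ch z j" "ch z j \<le> 1" if "z \<in> alcoved_simplex \<pi> s a" "j \<le> ?N" for z j
      using signed_chain_le_iff[OF s', of "ch z" ?N j] signed_chain_le_iff[OF s', of "ch z" j 0] that
      by (auto simp: mem ends simp del: One_nat_def)
    have diff_iff: "ch x j - ch x k \<le> of_int e \<longleftrightarrow> ch y j - ch y k \<le> of_int e"
      if jk: "j \<le> ?N" "k \<le> ?N" for j k and e :: int
    proof -
      have b: "0 \<le> ch x j" "ch x j \<le> 1" "0 \<le> ch x k" "ch x k \<le> 1"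
        "0 \<le> ch y j" "ch y j \<le> 1" "0 \<le> ch y k" "ch y k \<le> 1"
        using bounds x y jk by blast+
      \<comment> \<open>Chain terms lie in \<open>[0,1]\<close>, so thresholds from 1 up always hold
        and those from -2 down never do. At -1 the two terms must be 0 and 1, which is a comparison
        with the ends of the chain.\<close>
      consider "e \<ge> 1" | "e = 0" | "e = -1" | "e \<le> -2" by linarith
      then show ?thesis
      proof cases
        case 1
        then have "(1::real) \<le> of_int e" by simp
        with b show ?thesis by linarith
      next
        case 2
        then show ?thesis using le_iff[OF jk] by simp
      next
        case 3
        have "ch z j - ch z k \<le> -1 \<longleftrightarrow> ch z j \<le> ch z ?N \<and> ch z 0 \<le> ch z k"
          if "z = x \<or> z = y" for z
          using that b by (auto simp only: ends)
        then show ?thesis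
          using 3 le_iff[OF jk(1), of ?N] le_iff[OF _ jk(2), of 0] by simp
      next
        case 4
        then have "of_int e \<le> (-2 :: real)" by simp
        with b show ?thesis by linarith
      qed
    qed
    show ?thesis
      unfolding same_alcove_def
    proof (intro allI)
      fix p q :: "'n option" and c :: int
      obtain j k where jk: "j \<in> {1..?N}" "alcove_index \<pi> j = p" "k \<in> {1..?N}" "alcove_index \<pi> k = q"
        using alcove_index_surj[OF \<pi>] by metis
      let ?e = "c - alcove_offset \<pi> a j + alcove_offset \<pi> a k"
      have "hom z p - hom z q \<le> of_int c \<longleftrightarrow> ch z j - ch z k \<le> of_int ?e" for z
        using hom_ch[of z j] hom_ch[of z k] jk by auto
      then show "hom x p - hom x q \<le> of_int c \<longleftrightarrow> hom y p - hom y q \<le> of_int c"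
        using diff_iff[of j k ?e] jk by simp
    qed
  qed
  moreover have "y \<in> alcoved_simplex \<pi> s a" if y: "same_alcove x y" for y
  proof -
    have le_iff: "ch x j \<le> ch x k \<longleftrightarrow> ch y j \<le> ch y k" for j k
    proof -
      have "ch z j \<le> ch z k \<longleftrightarrow> hom z (alcove_index \<pi> j) - hom z (alcove_index \<pi> k)
          \<le> of_int (alcove_offset \<pi> a j - alcove_offset \<pi> a k)" for z
        by (auto simp: hom_ch)
      then show ?thesis
        using y unfolding same_alcove_def by blast
    qed
    show ?thesis
      unfolding mem
    proof
      fix j assume j: "j \<in> {1..?N}"
      then have "s j \<in> {(=), (<)}" "s j (ch x j) (ch x (j - 1))"
        using s' x mem by blast+
      then show "s j (ch y j) (ch y (j - 1))"
        using le_iff[of j "j - 1"] le_iff[of "j - 1" j] by auto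
    qed
  qed
  ultimately show ?thesis by blast
qed

text \<open>Take floors for \<open>a\<close>, order the coordinates by decreasing fractional part
  (hence the minus sign in the sort key), and let \<open>s\<close> record the ties.\<close>

lemma exists_alcoved_simplex:
  fixes x :: "real ^ 'n::finite"
  obtains \<pi> s a where "is_perm \<pi>" "s \<in> open_signs TYPE('n)" "x \<in> alcoved_simplex \<pi> s a"
proof -
  obtain ys :: "'n list" where ys: "set ys = UNIV" "distinct ys"
    using finite_distinct_list[of "UNIV :: 'n set"] by auto
  define xs where "xs = sort_key (\<lambda>i. - frac (x $ i)) ys"
  have xs: "set xs = UNIV" "distinct xs" "sorted (map (\<lambda>i. - frac (x $ i)) xs)"
    using ys by (simp_all add: xs_def)
  have len: "length xs = CARD('n)"
    using xs distinct_card by force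
  define \<pi> where "\<pi> j = xs ! (j - 1)" for j
  define a :: "int ^ 'n" where "a = (\<chi> i. \<lfloor>x $ i\<rfloor>)"
  define c where "c = alcove_chain \<pi> (x - (\<chi> i. real_of_int (a $ i)))"
  define s where "s j = (if c j = c (j - 1) then (=) else ((<) :: real \<Rightarrow> real \<Rightarrow> bool))" for j
  have "bij_betw (\<lambda>j. j - 1) {1..CARD('n)} {..<length xs}"
    by (rule bij_betw_byWitness[where f' = Suc]) (auto simp: len)
  then have "bij_betw ((!) xs \<circ> (\<lambda>j. j - 1)) {1..CARD('n)} (set xs)"
    by (rule bij_betw_trans) (rule bij_betw_nth[OF xs(2) refl refl])
  then have "is_perm \<pi>"
    by (simp add: is_perm_def \<pi>_def[abs_def] comp_def xs(1))
  moreover have "s \<in> open_signs TYPE('n)"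
    by (simp add: open_signs_def s_def)
  moreover have "x \<in> alcoved_simplex \<pi> s a"
    unfolding mem_alcoved_simplex_iff c_def[symmetric]
  proof
    fix j assume j: "j \<in> {1..CARD('n) + 1}"
    have mid: "c k = frac (x $ \<pi> k)" if "1 \<le> k" "k \<le> CARD('n)" for k
      using that by (simp add: c_def alcove_chain_def a_def frac_def)
    have ends: "c 0 = 1" "c (CARD('n) + 1) = 0"
      by (simp_all add: c_def alcove_chain_def)
    have "c j \<le> c (j - 1)"
    proof (cases "j = 1 \<or> j = CARD('n) + 1")
      case True
      then show ?thesis
        using mid[of 1] mid[of "CARD('n)"] ends frac_lt_1[of "x $ \<pi> 1"] frac_ge_0[of "x $ \<pi> CARD('n)"]
        by (auto simp: less_imp_le Suc_leI)
    next
      case False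
      with j have j': "2 \<le> j" "j \<le> CARD('n)" by auto
      have "map (\<lambda>i. - frac (x $ i)) xs ! (j - 2) \<le> map (\<lambda>i. - frac (x $ i)) xs ! (j - 1)"
        by (rule sorted_nth_mono[OF xs(3)]) (use j' len in auto)
      then have "frac (x $ \<pi> j) \<le> frac (x $ \<pi> (j - 1))"
        using j' len by (simp add: \<pi>_def numeral_2_eq_2)
      then show ?thesis using mid[of j] mid[of "j - 1"] j' by simp
    qed
    then show "s j (c j) (c (j - 1))"
      by (simp add: s_def)
  qed
  ultimately show ?thesis by (rule that)
qed

text \<open>This reduces covering and disjointness of the cells to facts about an equivalence
  relation.\<close>

lemma alcoved_triangulation_eq_classes:
  fixes P :: "(real ^ 'n::finite) set"
  assumes "\<And>x y. x \<in> P \<Longrightarrow> same_alcove x y \<Longrightarrow> y \<in> P"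
  shows "alcoved_triangulation P = (\<lambda>x. {y. same_alcove x y}) ` P"
proof (intro equalityI subsetI)
  fix C assume "C \<in> alcoved_triangulation P"
  then obtain \<pi> s a where C: "C = alcoved_simplex \<pi> s a" "is_perm \<pi>" "s \<in> open_signs TYPE('n)"
    "C \<noteq> {}" "C \<subseteq> P"
    by (auto simp: alcoved_triangulation_def)
  then obtain x where "x \<in> C" by blast
  then show "C \<in> (\<lambda>x. {y. same_alcove x y}) ` P"
    using C alcoved_simplex_eq_class[of \<pi> s x a] by blast
next
  fix C assume "C \<in> (\<lambda>x. {y. same_alcove x y}) ` P"
  then obtain x where x: "x \<in> P" "C = {y. same_alcove x y}" by blast
  obtain \<pi> s a where \<pi>: "is_perm \<pi>" "s \<in> open_signs TYPE('n)" "x \<in> alcoved_simplex \<pi> s a"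
    using exists_alcoved_simplex .
  then have "C = alcoved_simplex \<pi> s a"
    using alcoved_simplex_eq_class x(2) by blast
  moreover have "C \<noteq> {}" "C \<subseteq> P"
    using x assms same_alcove_refl by blast+
  ultimately show "C \<in> alcoved_triangulation P"
    using \<pi> unfolding alcoved_triangulation_def by blast
qed

text \<open>With \<open>p\<close> and \<open>q\<close> exchanged the hypothesis also bounds
  differences from below, so thresholds outside \<open>{-M - 1..M}\<close> separate no points; the
  finite record \<open>D x\<close> of the remaining answers determines the class of
  \<open>x\<close>.\<close>

lemma finite_alcove_classes:
  fixes P :: "(real ^ 'n::finite) set"
  assumes "\<And>x p q. x \<in> P \<Longrightarrow> hom x p - hom x q \<le> of_int M"
  shows "finite ((\<lambda>x. {y. same_alcove x y}) ` P)"
proof -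
  define D where "D x = {(p, q, c). c \<in> {-M - 1..M} \<and> hom x p - hom x q \<le> of_int c}" for x :: "real ^ 'n"
  have "finite (UNIV \<times> UNIV \<times> {-M - 1..M} :: ('n option \<times> 'n option \<times> int) set)"
    by simp
  then have "finite (D ` P)"
    by (rule finite_subset[rotated, OF finite_Pow_iff[THEN iffD2]]) (auto simp: D_def)
  have same: "same_alcove x y" if xy: "x \<in> P" "y \<in> P" "D x = D y" for x y
    unfolding same_alcove_def
  proof (intro allI)
    fix p q and c :: int
    have b: "hom z p - hom z q \<le> of_int M" "- of_int M \<le> hom z p - hom z q" if "z \<in> P" for z
      using assms[OF that, of p q] assms[OF that, of q p] by linarith+
    consider "c < -M - 1" | "c \<in> {-M - 1..M}" | "M < c" by force
    then show "hom x p - hom x q \<le> of_int c \<longleftrightarrow> hom y p - hom y q \<le> of_int c"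
    proof cases
      case 1
      then have "of_int c < (- of_int M :: real)" by linarith
      then show ?thesis using b xy by fastforce
    next
      case 2
      then have "hom z p - hom z q \<le> of_int c \<longleftrightarrow> (p, q, c) \<in> D z" for z
        by (simp add: D_def)
      then show ?thesis using xy(3) by simp
    next
      case 3
      then have "of_int M < (of_int c :: real)" by simp
      then show ?thesis using b xy by fastforce
    qed
  qed
  have "(\<lambda>x. {y. same_alcove x y}) ` P = (\<lambda>d. {y. same_alcove (SOME x. x \<in> P \<and> D x = d) y}) ` D ` P"
  proof -
    have "{y. same_alcove x y} = {y. same_alcove (SOME z. z \<in> P \<and> D z = D x) y}" if "x \<in> P" for x
    proof -
      have "(SOME z. z \<in> P \<and> D z = D x) \<in> P \<and> D (SOME z. z \<in> P \<and> D z = D x) = D x"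
        by (rule someI[of "\<lambda>z. z \<in> P \<and> D z = D x" x]) (use that in simp)
      then have "same_alcove x (SOME z. z \<in> P \<and> D z = D x)"
        using same that by metis
      then show ?thesis
        using same_alcove_sym same_alcove_trans by blast
    qed
    then show ?thesis
      unfolding image_image by (rule image_cong[OF refl])
  qed
  with \<open>finite (D ` P)\<close> show ?thesis by simp
qed

section \<open>Barycentric coordinates of alcoved simplices\<close>

definition strict_positions :: "'n::finite itself \<Rightarrow> (nat \<Rightarrow> real \<Rightarrow> real \<Rightarrow> bool) \<Rightarrow> nat set" where
  "strict_positions _ s = {j \<in> {1..CARD('n) + 1}. s j = (<)}"

text \<open>
  A point of the \<open>t\<close>-fold dilated simplex is encoded by the differences \<open>\<mu> j\<close> of consecutive terms
  of its chain at the strict positions \<open>j\<close>. These are its barycentric coordinates, of sum \<open>t\<close>.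
\<close>

definition gap_tail :: "nat set \<Rightarrow> (nat \<Rightarrow> real) \<Rightarrow> nat \<Rightarrow> real" where
  "gap_tail S \<mu> l = sum \<mu> (S \<inter> {l<..})"

text \<open>Inverse of taking gaps: the chain ends at 0, so its term at position \<open>l\<close>
  telescopes to the sum of the gaps past \<open>l\<close>.\<close>

definition from_gaps :: "(nat \<Rightarrow> 'n::finite) \<Rightarrow> nat set \<Rightarrow> (nat \<Rightarrow> real) \<Rightarrow> real ^ 'n" where
  "from_gaps \<pi> S \<mu> = (\<chi> i. gap_tail S \<mu> (inv_into {1..CARD('n)} \<pi> i))"

definition dilated_chain :: "real \<Rightarrow> (nat \<Rightarrow> 'n::finite) \<Rightarrow> real ^ 'n \<Rightarrow> nat \<Rightarrow> real" where
  "dilated_chain t \<pi> x j = (if j = 0 then t else if j \<le> CARD('n) then x $ \<pi> j else 0)"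

definition dilated_alcove ::
  "real \<Rightarrow> (nat \<Rightarrow> 'n::finite) \<Rightarrow> (nat \<Rightarrow> real \<Rightarrow> real \<Rightarrow> bool) \<Rightarrow> (real ^ 'n) set" where
  "dilated_alcove t \<pi> s =
     {x. \<forall>j\<in>{1..CARD('n) + 1}. s j (dilated_chain t \<pi> x j) (dilated_chain t \<pi> x (j - 1))}"

text \<open>The fixed value 0 off \<open>S\<close> lets \<open>from_gaps\<close> be injective on
  these functions.\<close>

definition gap_vectors :: "nat set \<Rightarrow> real \<Rightarrow> (nat \<Rightarrow> real) set" where
  "gap_vectors S t = {\<mu>. (\<forall>j. j \<notin> S \<longrightarrow> \<mu> j = 0) \<and> sum \<mu> S = t}"

lemma alcoved_simplex_eq_translate:
  "alcoved_simplex \<pi> s a = (+) (\<chi> i. real_of_int (a $ i)) ` dilated_alcove 1 \<pi> s"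
proof -
  have "dilated_chain 1 \<pi> = alcove_chain \<pi>"
    by (intro ext) (simp add: dilated_chain_def alcove_chain_def)
  then show ?thesis
    by (simp only: alcoved_simplex_def dilated_alcove_def)
qed

lemma alcoved_simplex_0: "alcoved_simplex \<pi> s 0 = dilated_alcove 1 \<pi> s"
  for \<pi> :: "nat \<Rightarrow> 'n::finite"
proof -
  have "(\<chi> i. real_of_int ((0 :: int ^ 'n) $ i)) = 0"
    by (simp add: vec_eq_iff)
  then show ?thesis
    by (simp only: alcoved_simplex_eq_translate) simp
qed

lemma from_gaps_nth:
  fixes \<pi> :: "nat \<Rightarrow> 'n::finite"
  assumes "is_perm \<pi>" "1 \<le> j" "j \<le> CARD('n)"
  shows "from_gaps \<pi> S \<mu> $ \<pi> j = gap_tail S \<mu> j"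
  using assms by (simp add: from_gaps_def is_perm_def bij_betw_def inv_into_f_f)

lemma dilated_chain_from_gaps:
  fixes \<pi> :: "nat \<Rightarrow> 'n::finite"
  assumes "is_perm \<pi>" "S \<subseteq> {1..CARD('n) + 1}" "sum \<mu> S = t" "j \<le> CARD('n) + 1"
  shows "dilated_chain t \<pi> (from_gaps \<pi> S \<mu>) j = gap_tail S \<mu> j"
proof -
  consider "j = 0" | "1 \<le> j" "j \<le> CARD('n)" | "j = CARD('n) + 1"
    using assms(4) by linarith
  then show ?thesis
  proof cases
    case 1
    have "S \<inter> {0<..} = S" using assms(2) by auto
    then show ?thesis using 1 assms(3) by (simp add: dilated_chain_def gap_tail_def)
  next
    case 2
    then show ?thesis by (simp add: dilated_chain_def from_gaps_nth[OF assms(1)])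
  next
    case 3
    then have "S \<inter> {j<..} = {}" using assms(2) by auto
    then show ?thesis using 3 by (simp add: dilated_chain_def gap_tail_def)
  qed
qed

lemma gap_tail_step:
  assumes "finite S" "j \<ge> 1"
  shows "gap_tail S \<mu> (j - 1) = (if j \<in> S then \<mu> j else 0) + gap_tail S \<mu> j"
proof -
  have "{j - 1<..} = insert j {j<..}" using assms(2) by auto
  then have "S \<inter> {j - 1<..} = (if j \<in> S then insert j (S \<inter> {j<..}) else S \<inter> {j<..})" by auto
  then show ?thesis using assms(1) by (auto simp: gap_tail_def)
qed

text \<open>A gap is a difference of consecutive chain terms. The first term is no coordinate of the
  point, so it has to come from the equality of the sums.\<close>

lemma gaps_eqI:
  fixes \<pi> :: "nat \<Rightarrow> 'n::finite"
  assumes "is_perm \<pi>" "S \<subseteq> {1..CARD('n) + 1}" "sum \<mu> S = sum \<nu> S"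
    and "from_gaps \<pi> S \<mu> = from_gaps \<pi> S \<nu>" "j \<in> S"
  shows "\<mu> j = \<nu> j"
proof -
  have fin: "finite S" using assms(2) finite_subset by blast
  have "gap_tail S \<mu> l = gap_tail S \<nu> l" if "l \<le> CARD('n) + 1" for l
    using dilated_chain_from_gaps[OF assms(1,2) refl that, of \<mu>]
      dilated_chain_from_gaps[OF assms(1,2) refl that, of \<nu>] assms(3,4) by simp
  moreover have "j \<le> CARD('n) + 1" "j \<ge> 1"
    using assms(2,5) by auto
  ultimately have "gap_tail S \<mu> j = gap_tail S \<nu> j" "gap_tail S \<mu> (j - 1) = gap_tail S \<nu> (j - 1)"
    by simp_all
  then show ?thesis
    using gap_tail_step[OF fin, of j \<mu>] gap_tail_step[OF fin, of j \<nu>] assms(2,5) by auto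
qed

lemma inj_on_from_gaps:
  fixes \<pi> :: "nat \<Rightarrow> 'n::finite"
  assumes "is_perm \<pi>" "S \<subseteq> {1..CARD('n) + 1}"
  shows "inj_on (from_gaps \<pi> S) (gap_vectors S t)"
proof (rule inj_onI, rule ext)
  fix \<mu> \<nu> j
  assume "\<mu> \<in> gap_vectors S t" "\<nu> \<in> gap_vectors S t" "from_gaps \<pi> S \<mu> = from_gaps \<pi> S \<nu>"
  then show "\<mu> j = \<nu> j"
    using gaps_eqI[OF assms, of \<mu> \<nu> j] by (cases "j \<in> S") (simp_all add: gap_vectors_def)
qed

text \<open>Gaps at positions with \<open>(=)\<close> vanish, so those at strict positions, summed
  backwards from the final 0, recover the whole chain; strictness is positivity of the gap.\<close>

lemma dilated_alcove_eq_image: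
  fixes \<pi> :: "nat \<Rightarrow> 'n::finite"
  assumes \<pi>: "is_perm \<pi>" and s: "s \<in> open_signs TYPE('n)"
  defines "S \<equiv> strict_positions TYPE('n) s"
  shows "dilated_alcove t \<pi> s = from_gaps \<pi> S ` {\<mu> \<in> gap_vectors S t. \<forall>j\<in>S. 0 < \<mu> j}"
proof (intro equalityI subsetI)
  let ?N = "CARD('n) + 1"
  have S: "S \<subseteq> {1..?N}" "finite S"
    by (auto simp: S_def strict_positions_def)
  fix x assume "x \<in> dilated_alcove t \<pi> s"
  define c where "c = dilated_chain t \<pi> x"
  have c: "s j (c j) (c (j - 1))" if "j \<in> {1..?N}" for j
    using \<open>x \<in> dilated_alcove t \<pi> s\<close> that by (simp add: dilated_alcove_def c_def)
  have eq: "c (j - 1) = c j" if "j \<in> {1..?N}" "j \<notin> S" for j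
  proof -
    have "s j = (=)"
      using that s by (auto simp: S_def strict_positions_def open_signs_def)
    with c[OF that(1)] show ?thesis by simp
  qed
  define \<mu> where "\<mu> j = (if j \<in> S then c (j - 1) - c j else 0)" for j
  have tail: "gap_tail S \<mu> l = c l" if "l \<le> ?N" for l
    using that
  proof (induction rule: inc_induct)
    case base
    have "S \<inter> {?N<..} = {}" using S by auto
    then show ?case by (simp add: gap_tail_def c_def dilated_chain_def)
  next
    case (step l)
    then show ?case
      using gap_tail_step[OF S(2), of "Suc l" \<mu>] eq[of "Suc l"] \<mu>_def[of "Suc l"] by auto
  qed
  have "S \<inter> {0<..} = S" using S by auto
  then have "sum \<mu> S = t"
    using tail[of 0] by (simp add: gap_tail_def c_def dilated_chain_def)
  moreover have "\<mu> j > 0" if "j \<in> S" for j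
    using c[of j] that by (simp add: \<mu>_def S_def strict_positions_def)
  moreover have "x = from_gaps \<pi> S \<mu>"
  proof -
    have "x $ i = from_gaps \<pi> S \<mu> $ i" for i
    proof -
      have "i \<in> \<pi> ` {1..CARD('n)}"
        using \<pi> by (simp add: is_perm_def bij_betw_def)
      then obtain j where "j \<in> {1..CARD('n)}" "i = \<pi> j" by blast
      then show ?thesis
        using tail[of j] from_gaps_nth[OF \<pi>, of j S \<mu>] by (simp add: c_def dilated_chain_def)
    qed
    then show ?thesis by (simp add: vec_eq_iff)
  qed
  ultimately show "x \<in> from_gaps \<pi> S ` {\<mu> \<in> gap_vectors S t. \<forall>j\<in>S. 0 < \<mu> j}"
    by (auto simp: gap_vectors_def \<mu>_def)
next
  let ?N = "CARD('n) + 1"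
  have S: "S \<subseteq> {1..?N}" "finite S"
    by (auto simp: S_def strict_positions_def)
  fix x assume "x \<in> from_gaps \<pi> S ` {\<mu> \<in> gap_vectors S t. \<forall>j\<in>S. 0 < \<mu> j}"
  then obtain \<mu> where \<mu>: "x = from_gaps \<pi> S \<mu>" "sum \<mu> S = t" "\<forall>j\<in>S. 0 < \<mu> j"
    by (auto simp: gap_vectors_def)
  show "x \<in> dilated_alcove t \<pi> s"
    unfolding dilated_alcove_def
  proof (intro CollectI ballI)
    fix j assume j: "j \<in> {1..?N}"
    then have "s j = (if j \<in> S then (<) else (=))"
      using s by (auto simp: S_def strict_positions_def open_signs_def)
    moreover have "dilated_chain t \<pi> x j = gap_tail S \<mu> j"
      "dilated_chain t \<pi> x (j - 1) = gap_tail S \<mu> (j - 1)"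
      using dilated_chain_from_gaps[OF \<pi> S(1) \<mu>(2)] j unfolding \<mu>(1) by auto
    ultimately show "s j (dilated_chain t \<pi> x j) (dilated_chain t \<pi> x (j - 1))"
      using gap_tail_step[OF S(2), of j \<mu>] j \<mu>(3) by auto
  qed
qed

section \<open>Vertices, closure and dimension of a cell\<close>

text \<open>For \<open>j \<in> S\<close> this is a vertex of the simplex at the origin: its chain is
  1 before position \<open>j\<close> and 0 from \<open>j\<close> on, so its coordinates are 0 or
  1.\<close>

definition gap_vertex :: "(nat \<Rightarrow> 'n::finite) \<Rightarrow> nat set \<Rightarrow> nat \<Rightarrow> real ^ 'n" where
  "gap_vertex \<pi> S j = from_gaps \<pi> S (\<lambda>k. if k = j then 1 else 0)"

lemma from_gaps_eq_sum:
  assumes "finite S"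
  shows "from_gaps \<pi> S \<mu> = (\<Sum>j\<in>S. \<mu> j *\<^sub>R gap_vertex \<pi> S j)"
proof -
  have "gap_tail S \<mu> l = (\<Sum>j\<in>S. \<mu> j * gap_tail S (\<lambda>k. if k = j then 1 else 0) l)" for l
  proof -
    have "gap_tail S \<mu> l = (\<Sum>j\<in>S. if j \<in> {l<..} then \<mu> j else 0)"
      unfolding gap_tail_def by (rule sum.inter_restrict[OF assms])
    also have "\<dots> = (\<Sum>j\<in>S. \<mu> j * gap_tail S (\<lambda>k. if k = j then 1 else 0) l)"
      by (rule sum.cong) (use assms in \<open>auto simp: gap_tail_def sum.delta\<close>)
    finally show ?thesis .
  qed
  then show ?thesis by (simp add: vec_eq_iff from_gaps_def gap_vertex_def)
qed

lemma inj_on_gap_vertex: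
  fixes \<pi> :: "nat \<Rightarrow> 'n::finite"
  assumes "is_perm \<pi>" "S \<subseteq> {1..CARD('n) + 1}"
  shows "inj_on (gap_vertex \<pi> S) S"
proof (rule inj_onI)
  fix j k assume jk: "j \<in> S" "k \<in> S" "gap_vertex \<pi> S j = gap_vertex \<pi> S k"
  have "finite S" using assms(2) finite_subset by blast
  then have "(\<Sum>l\<in>S. if l = j then 1 else 0) = (\<Sum>l\<in>S. if l = k then 1 else (0::real))"
    using jk by (simp add: sum.delta)
  then show "j = k"
    using gaps_eqI[OF assms _ jk(3)[unfolded gap_vertex_def] jk(1)] by (auto split: if_splits)
qed

lemma sum_gap_vertex:
  fixes \<pi> :: "nat \<Rightarrow> 'n::finite"
  assumes "is_perm \<pi>" "S \<subseteq> {1..CARD('n) + 1}"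
  shows "(\<Sum>v\<in>gap_vertex \<pi> S ` S. f v) = (\<Sum>j\<in>S. f (gap_vertex \<pi> S j))"
  by (simp add: sum.reindex[OF inj_on_gap_vertex[OF assms]])

text \<open>The coefficients of an affine dependence form a gap vector of sum 0 that represents the
  origin, and \<open>gaps_eqI\<close> compares it with the zero vector.\<close>

lemma affine_independent_gap_vertices:
  fixes \<pi> :: "nat \<Rightarrow> 'n::finite"
  assumes "is_perm \<pi>" "S \<subseteq> {1..CARD('n) + 1}"
  shows "\<not> affine_dependent (gap_vertex \<pi> S ` S)"
proof
  have fin: "finite S" using assms(2) finite_subset by blast
  assume "affine_dependent (gap_vertex \<pi> S ` S)"
  then obtain U where U: "sum U (gap_vertex \<pi> S ` S) = 0" "\<exists>v\<in>gap_vertex \<pi> S ` S. U v \<noteq> 0"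
    "(\<Sum>v\<in>gap_vertex \<pi> S ` S. U v *\<^sub>R v) = 0"
    using affine_dependent_explicit_finite[of "gap_vertex \<pi> S ` S"] fin by auto
  define \<mu> where "\<mu> j = U (gap_vertex \<pi> S j)" for j
  have "sum \<mu> S = sum (\<lambda>_. 0) S"
    using U(1) by (simp add: sum_gap_vertex[OF assms] \<mu>_def)
  moreover have "from_gaps \<pi> S \<mu> = from_gaps \<pi> S (\<lambda>_. 0)"
    using U(3) by (simp add: sum_gap_vertex[OF assms] \<mu>_def from_gaps_eq_sum[OF fin])
  ultimately have "\<mu> j = 0" if "j \<in> S" for j
    using gaps_eqI[OF assms, of \<mu> "\<lambda>_. 0" j] that by simp
  with U(2) show False by (auto simp: \<mu>_def)
qed

text \<open>With \<open>R\<close> positivity this describes the relative interior of the simplex,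
  with \<open>R\<close> nonnegativity its convex hull.\<close>

lemma gap_vertices_combination:
  fixes \<pi> :: "nat \<Rightarrow> 'n::finite"
  assumes "is_perm \<pi>" "S \<subseteq> {1..CARD('n) + 1}"
  shows "{y. \<exists>u. (\<forall>v\<in>gap_vertex \<pi> S ` S. R (u v)) \<and> sum u (gap_vertex \<pi> S ` S) = 1 \<and>
            (\<Sum>v\<in>gap_vertex \<pi> S ` S. u v *\<^sub>R v) = y} =
         from_gaps \<pi> S ` {\<mu> \<in> gap_vectors S 1. \<forall>j\<in>S. R (\<mu> j)}" (is "?A = ?B")
proof (intro equalityI subsetI)
  have fin: "finite S" using assms(2) finite_subset by blast
  let ?v = "gap_vertex \<pi> S"
  {
    fix y assume "y \<in> ?A"
    then obtain u where u: "\<forall>j\<in>S. R (u (?v j))" "(\<Sum>j\<in>S. u (?v j)) = 1"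
      "(\<Sum>j\<in>S. u (?v j) *\<^sub>R ?v j) = y"
      by (auto simp: sum_gap_vertex[OF assms])
    define \<mu> where "\<mu> j = (if j \<in> S then u (?v j) else 0)" for j
    have "\<mu> \<in> {\<mu> \<in> gap_vectors S 1. \<forall>j\<in>S. R (\<mu> j)}" "y = from_gaps \<pi> S \<mu>"
      using u by (auto simp: gap_vectors_def from_gaps_eq_sum[OF fin] \<mu>_def cong: sum.cong)
    then show "y \<in> ?B" by blast
  next
    fix y assume "y \<in> ?B"
    then obtain \<mu> where \<mu>: "\<forall>j\<in>S. R (\<mu> j)" "sum \<mu> S = 1" "y = from_gaps \<pi> S \<mu>"
      by (auto simp: gap_vectors_def)
    define u where "u v = \<mu> (inv_into S ?v v)" for v
    have u: "u (?v j) = \<mu> j" if "j \<in> S" for j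
      using that inj_on_gap_vertex[OF assms] by (simp add: u_def)
    then show "y \<in> ?A"
      using \<mu> by (intro CollectI exI[of _ u])
        (simp add: sum_gap_vertex[OF assms] from_gaps_eq_sum[OF fin])
  }
qed

lemma alcove_eq_rel_interior:
  fixes \<pi> :: "nat \<Rightarrow> 'n::finite"
  assumes "is_perm \<pi>" "s \<in> open_signs TYPE('n)"
  defines "S \<equiv> strict_positions TYPE('n) s"
  shows "dilated_alcove 1 \<pi> s = rel_interior (convex hull (gap_vertex \<pi> S ` S))"
proof -
  have S: "S \<subseteq> {1..CARD('n) + 1}" by (auto simp: S_def strict_positions_def)
  show ?thesis
    unfolding rel_interior_convex_hull_explicit[OF affine_independent_gap_vertices[OF assms(1) S]]
      gap_vertices_combination[OF assms(1) S, where R = "\<lambda>r. 0 < r"]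
    unfolding S_def by (rule dilated_alcove_eq_image[OF assms(1,2)])
qed

text \<open>The open cell is the relative interior of a compact convex hull, so its closure is that
  hull.\<close>

lemma closure_alcove:
  fixes \<pi> :: "nat \<Rightarrow> 'n::finite"
  assumes "is_perm \<pi>" "s \<in> open_signs TYPE('n)"
  defines "S \<equiv> strict_positions TYPE('n) s"
  shows "closure (dilated_alcove 1 \<pi> s) = from_gaps \<pi> S ` {\<mu> \<in> gap_vectors S 1. \<forall>j\<in>S. 0 \<le> \<mu> j}"
proof -
  have S: "S \<subseteq> {1..CARD('n) + 1}" "finite S" by (auto simp: S_def strict_positions_def)
  let ?V = "gap_vertex \<pi> S ` S"
  have "closure (dilated_alcove 1 \<pi> s) = closure (convex hull ?V)"
    unfolding alcove_eq_rel_interior[OF assms(1,2)] S_def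
    by (rule convex_closure_rel_interior[OF convex_convex_hull])
  also have "\<dots> = convex hull ?V"
    using S(2) by (intro closure_closed compact_imp_closed finite_imp_compact_convex_hull) simp
  also have "\<dots> = from_gaps \<pi> S ` {\<mu> \<in> gap_vectors S 1. \<forall>j\<in>S. 0 \<le> \<mu> j}"
    using convex_hull_finite[of ?V] S(2)
      gap_vertices_combination[OF assms(1) S(1), where R = "\<lambda>r. 0 \<le> r"] by simp
  finally show ?thesis .
qed

lemma aff_dim_alcoved_simplex:
  fixes \<pi> :: "nat \<Rightarrow> 'n::finite"
  assumes "is_perm \<pi>" "s \<in> open_signs TYPE('n)"
  shows "aff_dim (alcoved_simplex \<pi> s a) = int (card (strict_positions TYPE('n) s)) - 1"
proof -
  define S where "S = strict_positions TYPE('n) s"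
  have S: "S \<subseteq> {1..CARD('n) + 1}" "finite S" by (auto simp: S_def strict_positions_def)
  have "aff_dim (alcoved_simplex \<pi> s a) = aff_dim (rel_interior (convex hull (gap_vertex \<pi> S ` S)))"
    by (simp add: alcoved_simplex_eq_translate aff_dim_translation_eq alcove_eq_rel_interior[OF assms] S_def)
  also have "\<dots> = int (card (gap_vertex \<pi> S ` S)) - 1"
    using aff_dim_affine_independent[OF affine_independent_gap_vertices[OF assms(1) S(1)]]
    by (simp add: rel_interior_aff_dim aff_dim_convex_hull)
  also have "card (gap_vertex \<pi> S ` S) = card S"
    by (rule card_image[OF inj_on_gap_vertex[OF assms(1) S(1)]])
  finally show ?thesis by (simp add: S_def)
qed

lemma strict_positions_nonempty:
  fixes \<pi> :: "nat \<Rightarrow> 'n::finite"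
  assumes "is_perm \<pi>" "s \<in> open_signs TYPE('n)" "alcoved_simplex \<pi> s a \<noteq> {}"
  shows "strict_positions TYPE('n) s \<noteq> {}"
proof
  assume "strict_positions TYPE('n) s = {}"
  then have "aff_dim (alcoved_simplex \<pi> s a) = -1"
    by (simp add: aff_dim_alcoved_simplex[OF assms(1,2)])
  with assms(3) show False by (simp add: aff_dim_empty)
qed

section \<open>Lattice points of a cell\<close>

text \<open>The integer points of the linear span of the cone over the simplex scaled by D_b^a: the
  sum is the height, and \<open>b ^ nat (a $ i)\<close> is the diagonal entry of
  \<open>diag_pow b a\<close> for nonnegative \<open>a\<close>.\<close>

definition lattice_gaps :: "nat \<Rightarrow> (nat \<Rightarrow> 'n::finite) \<Rightarrow> nat set \<Rightarrow> int ^ 'n \<Rightarrow> (nat \<Rightarrow> real) set" where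
  "lattice_gaps b \<pi> S a = {\<mu>. (\<forall>j. j \<notin> S \<longrightarrow> \<mu> j = 0) \<and> sum \<mu> S \<in> \<int> \<and>
     (\<forall>i. real b ^ nat (a $ i) * from_gaps \<pi> S \<mu> $ i \<in> \<int>)}"

lemma from_gaps_diff: "from_gaps \<pi> S (\<lambda>j. \<mu> j - \<nu> j) = from_gaps \<pi> S \<mu> - from_gaps \<pi> S \<nu>"
  by (simp add: vec_eq_iff from_gaps_def gap_tail_def sum_subtractf)

lemma from_gaps_scale: "from_gaps \<pi> S (\<lambda>j. c * \<mu> j) = c *\<^sub>R from_gaps \<pi> S \<mu>"
  by (simp add: vec_eq_iff from_gaps_def gap_tail_def sum_distrib_left)

text \<open>The vertices have coordinates 0 and 1, so integer gaps give integer points. Finiteness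
  of the parallelepiped comes from bounded denominators.\<close>

lemma gap_lattice_lattice_gaps:
  fixes \<pi> :: "nat \<Rightarrow> 'n::finite"
  assumes "is_perm \<pi>" "S \<subseteq> {1..CARD('n) + 1}" "card S = Suc m" "b \<ge> 1"
  shows "gap_lattice S m (lattice_gaps b \<pi> S a)"
proof
  have fin: "finite S" using assms(2) finite_subset by blast
  show "card S = Suc m" by fact
  show "(\<lambda>j. \<mu> j - \<nu> j) \<in> lattice_gaps b \<pi> S a"
    if "\<mu> \<in> lattice_gaps b \<pi> S a" "\<nu> \<in> lattice_gaps b \<pi> S a" for \<mu> \<nu>
    using that by (simp add: lattice_gaps_def from_gaps_diff sum_subtractf right_diff_distrib)
  show "(\<lambda>j. of_int (n j)) \<in> lattice_gaps b \<pi> S a" if "\<And>j. j \<notin> S \<Longrightarrow> n j = 0" for n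
    using that by (auto simp: lattice_gaps_def from_gaps_def gap_tail_def intro!: Ints_mult Ints_power Ints_sum)
  show "sum \<mu> S \<in> \<int>" if "\<mu> \<in> lattice_gaps b \<pi> S a" for \<mu>
    using that by (simp add: lattice_gaps_def)
  show "finite {\<phi> \<in> lattice_gaps b \<pi> S a. \<forall>j\<in>S. 0 \<le> \<phi> j \<and> \<phi> j < 1}"
  proof -
    \<comment> \<open>\<open>B\<close> is a common denominator: each \<open>b ^ nat (a $ i)\<close>
      divides it, so every chain term and hence every gap is a multiple of
      \<open>1 / B\<close>.\<close>
    define A where "A = (\<Sum>i\<in>UNIV. nat (a $ i))"
    define B where "B = real b ^ A"
    have B: "B > 0" "B \<in> \<int>" using assms(4) by (simp_all add: B_def)
    have tail: "B * gap_tail S \<phi> l \<in> \<int>" if \<phi>: "\<phi> \<in> lattice_gaps b \<pi> S a" and l: "l \<le> CARD('n) + 1" for \<phi> l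
    proof -
      have chain: "gap_tail S \<phi> l = dilated_chain (sum \<phi> S) \<pi> (from_gaps \<pi> S \<phi>) l"
        using dilated_chain_from_gaps[OF assms(1,2) refl l] by simp
      have "B * from_gaps \<pi> S \<phi> $ i \<in> \<int>" for i
      proof -
        have "nat (a $ i) \<le> A"
          unfolding A_def by (rule member_le_sum) auto
        then have "B = real b ^ (A - nat (a $ i)) * real b ^ nat (a $ i)"
          by (simp add: B_def flip: power_add)
        then have "B * from_gaps \<pi> S \<phi> $ i =
            real b ^ (A - nat (a $ i)) * (real b ^ nat (a $ i) * from_gaps \<pi> S \<phi> $ i)"
          by (simp add: mult.assoc)
        moreover have "real b ^ nat (a $ i) * from_gaps \<pi> S \<phi> $ i \<in> \<int>"
          using \<phi> by (simp add: lattice_gaps_def)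
        ultimately show ?thesis
          by (metis Ints_mult Ints_of_nat Ints_power)
      qed
      moreover have "B * sum \<phi> S \<in> \<int>"
        using \<phi> B by (auto simp: lattice_gaps_def intro: Ints_mult)
      ultimately show ?thesis
        unfolding chain dilated_chain_def by simp
    qed
    have "\<phi> j \<in> (\<lambda>n. of_int n / B) ` {0..\<lfloor>B\<rfloor>}"
      if \<phi>: "\<phi> \<in> lattice_gaps b \<pi> S a" and j: "j \<in> S" and bd: "0 \<le> \<phi> j" "\<phi> j < 1" for \<phi> j
    proof -
      have j': "j \<ge> 1" "j \<le> CARD('n) + 1" using assms(2) j by auto
      have "B * \<phi> j = B * gap_tail S \<phi> (j - 1) - B * gap_tail S \<phi> j"
        using gap_tail_step[OF fin j'(1), of \<phi>] j by (simp add: algebra_simps)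
      then have "B * \<phi> j \<in> \<int>"
        using tail[OF \<phi>, of "j - 1"] tail[OF \<phi>, of j] j' by simp
      then obtain n where n: "B * \<phi> j = of_int n"
        by (rule Ints_cases)
      have "0 \<le> B * \<phi> j" "B * \<phi> j \<le> B"
        using bd B by simp_all
      then have "n \<in> {0..\<lfloor>B\<rfloor>}"
        unfolding n by (simp add: le_floor_iff)
      moreover have "\<phi> j = of_int n / B"
        using n B by (simp add: field_simps)
      ultimately show ?thesis by blast
    qed
    then have "{\<phi> \<in> lattice_gaps b \<pi> S a. \<forall>j\<in>S. 0 \<le> \<phi> j \<and> \<phi> j < 1} \<subseteq>
        {\<phi>. \<forall>j. (j \<in> S \<longrightarrow> \<phi> j \<in> (\<lambda>n. of_int n / B) ` {0..\<lfloor>B\<rfloor>}) \<and> (j \<notin> S \<longrightarrow> \<phi> j = 0)}"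
      by (auto simp: lattice_gaps_def)
    then show ?thesis
      by (rule finite_subset) (intro finite_set_of_finite_funs fin finite_imageI finite_atLeastAtMost_int)
  qed
qed

lemma diag_pow_mult:
  fixes a :: "int ^ 'n::finite"
  assumes "\<forall>i. 0 \<le> a $ i"
  shows "diag_pow b a *v x = (\<chi> i. real b ^ nat (a $ i) * x $ i)"
proof -
  have "(\<Sum>j\<in>UNIV. (if i = j then real b powi (a $ i) else 0) * x $ j) = real b powi (a $ i) * x $ i" for i
  proof -
    have "(\<Sum>j\<in>UNIV. (if i = j then real b powi (a $ i) else 0) * x $ j) =
        (\<Sum>j\<in>UNIV. if i = j then real b powi (a $ i) * x $ j else 0)"
      by (rule sum.cong) auto
    then show ?thesis by simp
  qed
  then show ?thesis
    using assms by (simp add: vec_eq_iff diag_pow_def matrix_vector_mult_def power_int_def)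
qed

text \<open>Dilating by \<open>k\<close> multiplies the gaps by \<open>k\<close> and carries sum 1
  to sum \<open>k\<close>; for \<open>k \<ge> 1\<close> this can be undone.\<close>

lemma lattice_points_dilated_closure:
  fixes \<pi> :: "nat \<Rightarrow> 'n::finite" and k :: nat
  assumes \<pi>: "is_perm \<pi>" and s: "s \<in> open_signs TYPE('n)" and a: "\<forall>i. 0 \<le> a $ i"
    and b: "b \<ge> 1" and k: "k \<ge> 1"
  defines "S \<equiv> strict_positions TYPE('n) s"
  shows "card ((\<lambda>x. real k *\<^sub>R x) ` (\<lambda>x. diag_pow b a *v x) ` closure (alcoved_simplex \<pi> s 0) \<inter> int_lattice) =
    card {\<mu> \<in> lattice_gaps b \<pi> S a. (\<forall>j\<in>S. 0 \<le> \<mu> j) \<and> sum \<mu> S = real k}"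
proof -
  have S: "S \<subseteq> {1..CARD('n) + 1}" by (auto simp: S_def strict_positions_def)
  let ?G = "{\<mu> \<in> lattice_gaps b \<pi> S a. (\<forall>j\<in>S. 0 \<le> \<mu> j) \<and> sum \<mu> S = real k}"
  let ?f = "\<lambda>\<mu>. diag_pow b a *v from_gaps \<pi> S \<mu>"
  have lattice: "?f \<mu> \<in> int_lattice \<longleftrightarrow> (\<forall>i. real b ^ nat (a $ i) * from_gaps \<pi> S \<mu> $ i \<in> \<int>)" for \<mu>
    by (simp add: diag_pow_mult[OF a] int_lattice_def)
  have scale: "real k *\<^sub>R ?f \<nu> = ?f (\<lambda>j. real k * \<nu> j)" for \<nu>
    by (simp add: from_gaps_scale diag_pow_mult[OF a] vec_eq_iff)
  have "inj_on ?f ?G"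
  proof (rule inj_onI)
    fix \<mu> \<nu> assume \<mu>: "\<mu> \<in> ?G" and \<nu>: "\<nu> \<in> ?G" and "?f \<mu> = ?f \<nu>"
    then have "from_gaps \<pi> S \<mu> = from_gaps \<pi> S \<nu>"
      using b by (simp add: diag_pow_mult[OF a] vec_eq_iff)
    moreover have "\<mu> \<in> gap_vectors S k" "\<nu> \<in> gap_vectors S k"
      using \<mu> \<nu> by (simp_all add: lattice_gaps_def gap_vectors_def)
    ultimately show "\<mu> = \<nu>"
      using inj_on_from_gaps[OF \<pi> S] by (meson inj_onD)
  qed
  moreover have "(\<lambda>x. real k *\<^sub>R x) ` (\<lambda>x. diag_pow b a *v x) ` closure (alcoved_simplex \<pi> s 0) \<inter> int_lattice =
      ?f ` ?G"
  proof (intro equalityI subsetI)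
    fix y assume y: "y \<in> (\<lambda>x. real k *\<^sub>R x) ` (\<lambda>x. diag_pow b a *v x) ` closure (alcoved_simplex \<pi> s 0) \<inter> int_lattice"
    then obtain \<nu> where \<nu>: "\<nu> \<in> gap_vectors S 1" "\<forall>j\<in>S. 0 \<le> \<nu> j" "y = ?f (\<lambda>j. real k * \<nu> j)"
      unfolding alcoved_simplex_0 closure_alcove[OF \<pi> s, folded S_def] by (auto simp: scale)
    then have "(\<lambda>j. real k * \<nu> j) \<in> ?G"
      using y by (auto simp: gap_vectors_def lattice_gaps_def lattice simp flip: sum_distrib_left)
    then show "y \<in> ?f ` ?G" using \<nu>(3) by blast
  next
    fix y assume "y \<in> ?f ` ?G"
    then obtain \<mu> where \<mu>: "\<mu> \<in> ?G" "y = ?f \<mu>" by blast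
    define \<nu> where "\<nu> j = \<mu> j / real k" for j
    have "\<nu> \<in> {\<nu> \<in> gap_vectors S 1. \<forall>j\<in>S. 0 \<le> \<nu> j}"
      using \<mu>(1) k by (simp add: gap_vectors_def lattice_gaps_def \<nu>_def flip: sum_divide_distrib)
    moreover have "y = real k *\<^sub>R ?f \<nu>"
      unfolding scale \<mu>(2) using k by (simp add: \<nu>_def)
    moreover have "y \<in> int_lattice"
      using \<mu> by (simp add: lattice lattice_gaps_def)
    ultimately show "y \<in> (\<lambda>x. real k *\<^sub>R x) ` (\<lambda>x. diag_pow b a *v x) ` closure (alcoved_simplex \<pi> s 0) \<inter> int_lattice"
      unfolding alcoved_simplex_0 closure_alcove[OF \<pi> s, folded S_def] by blast
  qed
  ultimately show ?thesis by (simp add: card_image)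
qed

text \<open>The map \<open>v \<mapsto> log b (1 + v / b ^ k)\<close> is strictly increasing for
  \<open>v > - b ^ k\<close> and sends 0 to 0 and \<open>(b - 1) * b ^ k\<close> to
  \<open>log b b = 1\<close>, so it respects all signs and both ends of the chain.\<close>

lemma log_alcove_iff:
  fixes \<pi> :: "nat \<Rightarrow> 'n::finite"
  assumes s: "s \<in> open_signs TYPE('n)" and b: "b \<ge> 2" and y: "\<forall>i. - (real b ^ k) < y $ i"
  shows "(\<chi> i. log b (1 + y $ i / real b ^ k)) \<in> dilated_alcove 1 \<pi> s \<longleftrightarrow>
    y \<in> dilated_alcove ((real b - 1) * real b ^ k) \<pi> s"
proof -
  let ?t = "(real b - 1) * real b ^ k"
  let ?f = "\<lambda>v. log b (1 + v / real b ^ k)"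
  have bk: "real b ^ k > 0" "real b > 1" using b by simp_all
  have chain: "dilated_chain 1 \<pi> (\<chi> i. ?f (y $ i)) j = ?f (dilated_chain ?t \<pi> y j)" for j
    using bk by (auto simp: dilated_chain_def)
  have pos: "0 < 1 + dilated_chain ?t \<pi> y j / real b ^ k" for j
    using bk y[rule_format, of "\<pi> j"] by (auto simp: dilated_chain_def field_simps add_pos_pos)
  have "s j (?f u) (?f v) \<longleftrightarrow> s j u v"
    if "j \<in> {1..CARD('n) + 1}" "0 < 1 + u / real b ^ k" "0 < 1 + v / real b ^ k" for j u v
  proof -
    have less: "?f u < ?f v \<longleftrightarrow> u < v" if "0 < 1 + u / real b ^ k" "0 < 1 + v / real b ^ k" for u v
      using that bk by (simp add: log_less_cancel_iff divide_less_cancel)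
    have "?f u = ?f v \<longleftrightarrow> u = v"
      using less[OF that(2,3)] less[OF that(3,2)] by (auto simp: not_less_iff_gr_or_eq)
    moreover have "s j = (=) \<or> s j = (<)" using s that(1) by (auto simp: open_signs_def)
    ultimately show ?thesis using less[OF that(2,3)] by (elim disjE) simp_all
  qed
  then show ?thesis
    unfolding dilated_alcove_def using pos by (simp add: chain)
qed

text \<open>The points counted in the \<open>k\<close>-fold tropical dilate, named by the integers
  whose logarithms they are. Zero entries must be excluded explicitly: their tropical logarithm is
  \<open>-\<infinity>\<close>, whereas the real \<open>log\<close> still assigns them a real
  value.\<close>

definition cell_points :: "nat \<Rightarrow> nat \<Rightarrow> (real ^ 'n) set \<Rightarrow> (nat ^ 'n) set" where
  "cell_points b k C = {z. (\<forall>i. z $ i \<ge> 1) \<and> (\<chi> i. log b (real (z $ i)) - real k) \<in> C}"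

text \<open>
  The substitution \<open>z\<^sub>i = b ^ a\<^sub>i * (b ^ k + y\<^sub>i)\<close> turns the chain of logarithms into
  a chain from \<open>0\<close> to \<open>(b - 1) * b ^ k\<close>.
\<close>

lemma card_cell_points:
  fixes \<pi> :: "nat \<Rightarrow> 'n::finite" and k :: nat
  assumes \<pi>: "is_perm \<pi>" and s: "s \<in> open_signs TYPE('n)" and a: "\<forall>i. 0 \<le> a $ i"
    and b: "b \<ge> 2"
  defines "S \<equiv> strict_positions TYPE('n) s"
  defines "G \<equiv> {\<mu> \<in> lattice_gaps b \<pi> S a. (\<forall>j\<in>S. 0 < \<mu> j) \<and> sum \<mu> S = real ((b - 1) * b ^ k)}"
  assumes "finite G"
  shows "finite (cell_points b k (alcoved_simplex \<pi> s a))"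
    and "card (cell_points b k (alcoved_simplex \<pi> s a)) = card G"
proof -
  let ?t = "real ((b - 1) * b ^ k)"
  have t: "?t = (real b - 1) * real b ^ k" using b by (simp add: of_nat_diff)
  have S: "S \<subseteq> {1..CARD('n) + 1}" "finite S" by (auto simp: S_def strict_positions_def)
  have bk: "real b ^ n > 0" "real b > 1" for n using b by simp_all
  let ?Z = "cell_points b k (alcoved_simplex \<pi> s a)"
  let ?g = "\<lambda>z. \<chi> i. real (z $ i) / real b ^ nat (a $ i) - real b ^ k"
  have "inj_on ?g ?Z"
    using bk(1) by (auto simp: inj_on_def vec_eq_iff)
  have "inj_on (from_gaps \<pi> S) G"
    by (rule inj_on_subset[OF inj_on_from_gaps[OF \<pi> S(1), of ?t]])
      (auto simp: G_def lattice_gaps_def gap_vectors_def)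
  have cell_iff: "z \<in> ?Z \<longleftrightarrow> ?g z \<in> dilated_alcove ?t \<pi> s" if z: "\<forall>i. z $ i \<ge> 1" for z
  proof -
    have mem: "x \<in> alcoved_simplex \<pi> s a \<longleftrightarrow> x - (\<chi> i. real_of_int (a $ i)) \<in> dilated_alcove 1 \<pi> s" for x
      unfolding alcoved_simplex_eq_translate
      by (metis (no_types, lifting) add_diff_cancel_left' diff_add_cancel add.commute image_iff)
    have "log b (real (z $ i)) - real k - real_of_int (a $ i) = log b (1 + ?g z $ i / real b ^ k)" for i
    proof -
      have "1 + ?g z $ i / real b ^ k = real (z $ i) / (real b ^ nat (a $ i) * real b ^ k)"
        using bk by (simp add: field_simps)
      also have "log b \<dots> = log b (real (z $ i)) - (real (nat (a $ i)) + real k)"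
        using bk z[rule_format, of i] by (simp add: log_divide log_mult log_nat_power)
      finally show ?thesis using a by (simp add: of_nat_nat)
    qed
    then have eq: "(\<chi> i. log b (real (z $ i)) - real k) - (\<chi> i. real_of_int (a $ i)) =
        (\<chi> i. log b (1 + ?g z $ i / real b ^ k))"
      by (simp add: vec_eq_iff)
    have pos: "\<forall>i. - (real b ^ k) < ?g z $ i"
      using bk z by (simp add: Suc_le_eq)
    have "z \<in> ?Z \<longleftrightarrow> (\<chi> i. log b (real (z $ i)) - real k) \<in> alcoved_simplex \<pi> s a"
      using z by (simp add: cell_points_def)
    also have "\<dots> \<longleftrightarrow> (\<chi> i. log b (1 + ?g z $ i / real b ^ k)) \<in> dilated_alcove 1 \<pi> s"
      unfolding mem eq ..
    also have "\<dots> \<longleftrightarrow> ?g z \<in> dilated_alcove ?t \<pi> s"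
      unfolding t by (rule log_alcove_iff[OF s b pos])
    finally show ?thesis .
  qed
  have image: "?g ` ?Z = from_gaps \<pi> S ` G"
  proof (intro equalityI subsetI)
    fix y assume "y \<in> ?g ` ?Z"
    then obtain z where z: "z \<in> ?Z" "y = ?g z" by blast
    then have "\<forall>i. z $ i \<ge> 1"
      by (simp add: cell_points_def)
    from cell_iff[OF this] z have "y \<in> dilated_alcove ?t \<pi> s"
      by blast
    then obtain \<mu> where \<mu>: "\<mu> \<in> gap_vectors S ?t" "\<forall>j\<in>S. 0 < \<mu> j" "y = from_gaps \<pi> S \<mu>"
      unfolding dilated_alcove_eq_image[OF \<pi> s, folded S_def] by blast
    \<comment> \<open>The subtracted shift is an integer, so integrality of \<open>z\<close> passes
      to \<open>y\<close> scaled by D_b^a.\<close>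
    have "real b ^ nat (a $ i) * y $ i = real (z $ i) - real b ^ nat (a $ i) * real b ^ k" for i
      using b by (simp add: z(2) right_diff_distrib)
    then have "\<forall>i. real b ^ nat (a $ i) * y $ i \<in> \<int>"
      by simp
    then have "\<mu> \<in> G"
      using \<mu> by (auto simp: G_def lattice_gaps_def gap_vectors_def)
    then show "y \<in> from_gaps \<pi> S ` G" using \<mu>(3) by blast
  next
    fix y assume "y \<in> from_gaps \<pi> S ` G"
    then obtain \<mu> where \<mu>: "\<mu> \<in> G" "y = from_gaps \<pi> S \<mu>" by blast
    \<comment> \<open>Nonnegative gaps give nonnegative coordinates, which makes the integers
      constructed below positive.\<close>
    have "\<forall>j\<in>S. 0 \<le> \<mu> j"
      using \<mu>(1) by (auto simp: G_def intro: less_imp_le)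
    then have y0: "0 \<le> y $ i" for i
      by (auto simp: \<mu>(2) from_gaps_def gap_tail_def intro!: sum_nonneg)
    have "\<exists>z :: nat. real z = real b ^ nat (a $ i) * (real b ^ k + y $ i)" for i
    proof -
      have "real b ^ nat (a $ i) * y $ i \<in> \<int>"
        using \<mu> by (simp add: G_def lattice_gaps_def)
      then have "real b ^ nat (a $ i) * (real b ^ k + y $ i) \<in> \<int>"
        unfolding distrib_left by simp
      then obtain c where c: "real b ^ nat (a $ i) * (real b ^ k + y $ i) = of_int c"
        by (rule Ints_cases)
      have "0 \<le> real b ^ nat (a $ i) * (real b ^ k + y $ i)"
        using y0[of i] by simp
      then show ?thesis unfolding c by (intro exI[of _ "nat c"]) simp
    qed
    then obtain h where h: "\<And>i. real (h i) = real b ^ nat (a $ i) * (real b ^ k + y $ i)" by metis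
    define z :: "nat ^ 'n" where "z = (\<chi> i. h i)"
    have "real (h i) > 0" for i
      unfolding h using bk y0[of i] by (simp add: add_pos_nonneg)
    then have z1: "\<forall>i. z $ i \<ge> 1"
      by (simp add: z_def Suc_le_eq)
    have y: "y = ?g z"
      using b by (simp add: z_def h vec_eq_iff)
    have "\<mu> \<in> {\<mu> \<in> gap_vectors S ?t. \<forall>j\<in>S. 0 < \<mu> j}"
      using \<mu>(1) by (simp add: G_def lattice_gaps_def gap_vectors_def)
    then have "y \<in> dilated_alcove ?t \<pi> s"
      unfolding dilated_alcove_eq_image[OF \<pi> s, folded S_def] \<mu>(2) by (rule imageI)
    then have "z \<in> ?Z"
      unfolding cell_iff[OF z1] y[symmetric] .
    with y show "y \<in> ?g ` ?Z"
      by (rule image_eqI)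
  qed
  show "card ?Z = card G"
    using card_image[OF \<open>inj_on ?g ?Z\<close>] card_image[OF \<open>inj_on (from_gaps \<pi> S) G\<close>] image by simp
  have "finite (?g ` ?Z)"
    unfolding image using \<open>finite G\<close> by (rule finite_imageI)
  then show "finite ?Z"
    using \<open>inj_on ?g ?Z\<close> by (rule finite_imageD)
qed

lemma poly_eqI_infinite:
  fixes p q :: "real poly"
  assumes "infinite A" "\<And>x. x \<in> A \<Longrightarrow> poly p x = poly q x"
  shows "p = q"
proof (rule ccontr)
  assume "p \<noteq> q"
  then have "finite {x. poly (p - q) x = 0}"
    by (intro poly_roots_finite) simp
  moreover have "A \<subseteq> {x. poly (p - q) x = 0}"
    using assms(2) by auto
  ultimately show False
    using assms(1) finite_subset by blast
qed

lemma ehrhart_polyI: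
  assumes "\<And>k :: nat. k \<ge> 1 \<Longrightarrow> real (card ((\<lambda>x. real k *\<^sub>R x) ` Q \<inter> int_lattice)) = poly p (real k)"
  shows "ehrhart_poly Q = p"
  unfolding ehrhart_poly_def
proof (rule the_equality)
  show "\<forall>k :: nat. k \<ge> 1 \<longrightarrow> real (card ((\<lambda>x. real k *\<^sub>R x) ` Q \<inter> int_lattice)) = poly p (real k)"
    using assms by blast
next
  fix q assume q: "\<forall>k :: nat. k \<ge> 1 \<longrightarrow> real (card ((\<lambda>x. real k *\<^sub>R x) ` Q \<inter> int_lattice)) = poly q (real k)"
  have "infinite (real ` {1..})"
    by (subst finite_image_iff) (auto simp: infinite_Ici)
  then show "q = p"
    by (rule poly_eqI_infinite) (use q assms in auto)
qed

text \<open>One polynomial serves both sides: its values at positive integers identify it as the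
  Ehrhart polynomial of the closed simplex, and its values at negative ones count the points of the
  open cell.\<close>

lemma cell_reciprocity:
  fixes \<pi> :: "nat \<Rightarrow> 'n::finite" and b :: nat
  assumes \<pi>: "is_perm \<pi>" and s: "s \<in> open_signs TYPE('n)" and a: "\<forall>i. 0 \<le> a $ i"
    and b: "b \<ge> 2" and ne: "alcoved_simplex \<pi> s a \<noteq> {}"
  defines "m \<equiv> nat (aff_dim (alcoved_simplex \<pi> s a))"
    and "p \<equiv> ehrhart_poly ((\<lambda>x. diag_pow b a *v x) ` closure (alcoved_simplex \<pi> s 0))"
  shows "aff_dim (alcoved_simplex \<pi> s a) = int m" "m \<le> CARD('n)" "degree p \<le> m"
    and "finite (cell_points b k (alcoved_simplex \<pi> s a))"
    and "real (card (cell_points b k (alcoved_simplex \<pi> s a))) =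
      (-1) ^ m * poly p (- ((real b - 1) * real b ^ k))"
proof -
  define S where "S = strict_positions TYPE('n) s"
  have S: "S \<subseteq> {1..CARD('n) + 1}" "finite S" "S \<noteq> {}"
    using strict_positions_nonempty[OF \<pi> s ne] by (auto simp: S_def strict_positions_def)
  have "card S \<le> card {1..CARD('n) + 1}"
    using S(1) by (intro card_mono) simp_all
  moreover have "card S > 0" using S(2,3) card_gt_0_iff by blast
  ultimately have m: "card S = Suc m" "m \<le> CARD('n)"
    "aff_dim (alcoved_simplex \<pi> s a) = int m"
    unfolding m_def aff_dim_alcoved_simplex[OF \<pi> s] S_def[symmetric] by auto
  then show "m \<le> CARD('n)" "aff_dim (alcoved_simplex \<pi> s a) = int m" by blast+
  interpret gap_lattice S m "lattice_gaps b \<pi> S a"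
    by (rule gap_lattice_lattice_gaps[OF \<pi> S(1) m(1)]) (use b in simp)
  obtain q where q: "degree q \<le> m"
    "\<And>t :: nat. real (card {\<mu> \<in> lattice_gaps b \<pi> S a. (\<forall>j\<in>S. 0 \<le> \<mu> j) \<and> sum \<mu> S = real t}) = poly q (real t)"
    "\<And>t :: nat. t \<ge> 1 \<Longrightarrow> finite {\<mu> \<in> lattice_gaps b \<pi> S a. (\<forall>j\<in>S. 0 < \<mu> j) \<and> sum \<mu> S = real t}"
    "\<And>t :: nat. t \<ge> 1 \<Longrightarrow> real (card {\<mu> \<in> lattice_gaps b \<pi> S a. (\<forall>j\<in>S. 0 < \<mu> j) \<and> sum \<mu> S = real t}) =
           (-1) ^ m * poly q (- real t)"
    by (rule reciprocity) blast
  have "p = q"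
    unfolding p_def
    by (rule ehrhart_polyI)
      (use lattice_points_dilated_closure[OF \<pi> s a] q(2) b in \<open>simp add: S_def\<close>)
  then show "degree p \<le> m" using q(1) by simp
  \<comment> \<open>Reciprocity needs a positive dilation; \<open>b \<ge> 2\<close> provides it even
    for \<open>k = 0\<close>.\<close>
  have t: "(b - 1) * b ^ k \<ge> 1" using b by (simp add: Suc_le_eq)
  have fin: "finite {\<mu> \<in> lattice_gaps b \<pi> S a. (\<forall>j\<in>S. 0 < \<mu> j) \<and> sum \<mu> S = real ((b - 1) * b ^ k)}"
    using q(3)[OF t] .
  show "finite (cell_points b k (alcoved_simplex \<pi> s a))"
    using card_cell_points(1)[OF \<pi> s a b fin[unfolded S_def]] .
  have "real ((b - 1) * b ^ k) = (real b - 1) * real b ^ k"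
    using b by (simp add: of_nat_diff)
  then show "real (card (cell_points b k (alcoved_simplex \<pi> s a))) =
      (-1) ^ m * poly p (- ((real b - 1) * real b ^ k))"
    using card_cell_points(2)[OF \<pi> s a b fin[unfolded S_def]] q(4)[OF t] \<open>p = q\<close>
    by (simp only: S_def)
qed

section \<open>The tropical Ehrhart polynomial\<close>

text \<open>As \<open>P\<close> is real, no point of its dilate has an entry
  \<open>tlog b 0 = -\<infinity>\<close>, and positive integers are determined by their
  logarithms.\<close>

lemma tropical_count_eq:
  fixes P :: "(real ^ 'n) set"
  assumes "b \<ge> 2"
  shows "tropical_count b (tvec ` P) k = card (cell_points b k P)"
proof -
  let ?f = "\<lambda>z :: nat ^ 'n. \<chi> i. tlog b (z $ i)"
  have "tropical_scale (ereal (real k)) (tvec ` P) \<inter> log_lattice b = ?f ` cell_points b k P"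
  proof (intro equalityI subsetI)
    fix y assume "y \<in> tropical_scale (ereal (real k)) (tvec ` P) \<inter> log_lattice b"
    then obtain x z where x: "x \<in> P" "y = (\<chi> i. ereal (real k + x $ i))" and z: "y = ?f z"
      by (auto simp: tropical_scale_def log_lattice_def tvec_def)
    have eq: "tlog b (z $ i) = ereal (real k + x $ i)" for i
      using x(2) z by (metis vec_lambda_beta)
    have pos: "z $ i \<ge> 1" for i
      using eq[of i] by (auto simp: tlog_def Suc_le_eq split: if_splits)
    have "log b (real (z $ i)) - real k = x $ i" for i
      using eq[of i] pos[of i] by (simp add: tlog_def split: if_splits)
    then have "(\<chi> i. log b (real (z $ i)) - real k) = x"
      by (simp add: vec_eq_iff)
    with pos x(1) have "z \<in> cell_points b k P"
      by (simp add: cell_points_def)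
    with z show "y \<in> ?f ` cell_points b k P" by blast
  next
    fix y assume "y \<in> ?f ` cell_points b k P"
    then obtain z where z: "y = ?f z" "\<forall>i. z $ i \<ge> 1" "(\<chi> i. log b (real (z $ i)) - real k) \<in> P"
      by (auto simp: cell_points_def)
    let ?x = "\<chi> i. log b (real (z $ i)) - real k"
    have "y = (\<chi> i. ereal (real k) + tvec ?x $ i)"
      using z(2) by (auto simp: z(1) vec_eq_iff tlog_def tvec_def Suc_le_eq)
    then have "y \<in> tropical_scale (ereal (real k)) (tvec ` P)"
      unfolding tropical_scale_def using z(3) by blast
    moreover have "y \<in> log_lattice b"
      unfolding log_lattice_def z(1) by blast
    ultimately show "y \<in> tropical_scale (ereal (real k)) (tvec ` P) \<inter> log_lattice b" by blast
  qed
  moreover have "inj_on ?f (cell_points b k P)"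
  proof (rule inj_onI)
    fix z w assume z: "z \<in> cell_points b k P" and w: "w \<in> cell_points b k P" and eq: "?f z = ?f w"
    have "z $ i = w $ i" for i
    proof -
      have "tlog b (z $ i) = tlog b (w $ i)"
        using eq by (simp add: vec_eq_iff)
      moreover have "0 < z $ i" "0 < w $ i"
        using z w by (auto simp: cell_points_def Suc_le_eq)
      ultimately have l: "log b (real (z $ i)) = log b (real (w $ i))"
        by (simp add: tlog_def)
      have "real (z $ i) = real (w $ i)"
        by (rule inj_onD[OF log_inj l]) (use assms \<open>0 < z $ i\<close> \<open>0 < w $ i\<close> in auto)
      then show ?thesis by simp
    qed
    then show "z = w" by (simp add: vec_eq_iff)
  qed
  ultimately show ?thesis
    by (simp add: tropical_count_def card_image)
qed

lemma tropical_ehrhart_polyI: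
  fixes P :: "(ereal ^ 'n::finite) set"
  assumes "b \<ge> 2" "degree p \<le> CARD('n)"
    and "\<And>k. real (tropical_count b P k) = poly p (real b ^ k)"
  shows "tropical_ehrhart_poly b P = p"
  unfolding tropical_ehrhart_poly_def
proof (rule the_equality)
  show "degree p \<le> CARD('n) \<and> (\<forall>k. real (tropical_count b P k) = poly p (real b ^ k))"
    using assms by blast
next
  fix q assume q: "degree q \<le> CARD('n) \<and> (\<forall>k. real (tropical_count b P k) = poly q (real b ^ k))"
  have "inj (\<lambda>k. real b ^ k)"
    using assms(1) by (auto simp: inj_def power_inject_exp)
  then have "infinite (range (\<lambda>k. real b ^ k))"
    using finite_imageD infinite_UNIV_nat by blast
  then show "q = p"
    by (rule poly_eqI_infinite) (use q assms(3) in auto)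
qed

lemma cell_points_classes:
  fixes P :: "(real ^ 'n::finite) set"
  assumes closed: "\<And>x y. x \<in> P \<Longrightarrow> same_alcove x y \<Longrightarrow> y \<in> P"
    and fin: "finite (alcoved_triangulation P)" "\<And>C. C \<in> alcoved_triangulation P \<Longrightarrow> finite (cell_points b k C)"
  shows "card (cell_points b k P) = (\<Sum>C\<in>alcoved_triangulation P. card (cell_points b k C))"
proof -
  have T: "alcoved_triangulation P = (\<lambda>x. {y. same_alcove x y}) ` P"
    by (rule alcoved_triangulation_eq_classes[OF closed])
  have "P = \<Union> (alcoved_triangulation P)"
    unfolding T using closed same_alcove_refl by blast
  then have "cell_points b k P = (\<Union>C\<in>alcoved_triangulation P. cell_points b k C)"
    unfolding cell_points_def by blast
  moreover have "cell_points b k C \<inter> cell_points b k D = {}"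
    if "C \<in> alcoved_triangulation P" "D \<in> alcoved_triangulation P" "C \<noteq> D" for C D
  proof -
    have "C \<inter> D = {}"
      using that same_alcove_sym same_alcove_trans unfolding T by blast
    then show ?thesis unfolding cell_points_def by blast
  qed
  ultimately show ?thesis
    by (simp add: card_UN_disjoint fin)
qed

text \<open>By the definition of the hull, each coordinate difference is at most the same difference
  at some generator.\<close>

lemma bounded_real_hull:
  fixes E :: "(real ^ 'n::finite) set"
  assumes "finite E"
  obtains M :: int where "\<And>x p q. x \<in> real_hull E \<Longrightarrow> hom x p - hom x q \<le> of_int M"
proof -
  let ?A = "(\<lambda>(v, p, q). hom v p - hom v q) ` (E \<times> UNIV \<times> UNIV)"
  have fin: "finite ?A" using assms by simp
  have "hom x p - hom x q \<le> of_int \<lceil>Max ?A\<rceil>" if "x \<in> real_hull E" for x p q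
  proof -
    obtain v where "v \<in> E" "hom x p - hom x q \<le> hom v p - hom v q"
      using \<open>x \<in> real_hull E\<close> by (auto simp: real_hull_def)
    moreover from this have "hom v p - hom v q \<le> Max ?A"
      by (intro Max_ge[OF fin] image_eqI[of _ _ "(v, p, q)"]) auto
    ultimately show ?thesis
      using le_of_int_ceiling[of "Max ?A"] by linarith
  qed
  then show ?thesis by (rule that)
qed

theorem theorem3p14:
  fixes b i :: nat
    and P :: "(real ^ 'n::finite) set"
    and R :: "((nat \<Rightarrow> 'n) \<times> (nat \<Rightarrow> real \<Rightarrow> real \<Rightarrow> bool) \<times> (int ^ 'n)) set"
  assumes "b \<ge> 2"
    and "tropical_polytope (tvec ` P)"
    and "tropical_vertices (tvec ` P) \<subseteq> tvec ` {v. \<forall>j. v $ j \<in> \<nat>}"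
    and "triangulation_labelling P R"
    and "i \<le> CARD('n)"
  shows "tropical_ehrhart_coeff b (tvec ` P) i =
    (\<Sum>(\<pi>, s, a)\<in>{(\<pi>, s, a)\<in>R. int i \<le> aff_dim (alcoved_simplex \<pi> s a)}.
       (-1) ^ (nat (aff_dim (alcoved_simplex \<pi> s a)) - i) * (real b - 1) ^ i *
       ehrhart_coeff ((\<lambda>x. diag_pow b a *v x) ` closure (alcoved_simplex \<pi> s 0)) i)"
proof -
  obtain E where E: "finite E" "tropical_vertices (tvec ` P) = tvec ` E" "real_hull E = P"
    using tropical_vertices_real[OF assms(2)] .
  have "E \<subseteq> {v. \<forall>j. v $ j \<in> \<nat>}"
    using assms(3) unfolding E(2) inj_image_subset_iff[OF inj_tvec] .
  then have int: "v $ j \<in> \<int>" if "v \<in> E" for v j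
    using that Nats_subset_Ints by blast
  have closed: "y \<in> P" if "x \<in> P" "same_alcove x y" for x y
    unfolding E(3)[symmetric]
    by (rule real_hull_same_alcove[OF _ _ that(2)]) (use int that(1) E(3) in auto)
  obtain M :: int where M: "\<And>x p q. x \<in> P \<Longrightarrow> hom x p - hom x q \<le> of_int M"
    using bounded_real_hull[OF E(1)] unfolding E(3) by blast
  have T: "alcoved_triangulation P = (\<lambda>x. {y. same_alcove x y}) ` P"
    by (rule alcoved_triangulation_eq_classes[OF closed])
  have finT: "finite (alcoved_triangulation P)"
    unfolding T by (rule finite_alcove_classes[OF M])
  define C where "C = (\<lambda>(\<pi> :: nat \<Rightarrow> 'n, s, a). alcoved_simplex \<pi> s a)"
  define p where "p = (\<lambda>(\<pi> :: nat \<Rightarrow> 'n, s, a). ehrhart_poly ((\<lambda>x. diag_pow b a *v x) ` closure (alcoved_simplex \<pi> s 0)))"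
  define m where "m r = nat (aff_dim (C r))" for r
  have R: "bij_betw C R (alcoved_triangulation P)"
    using assms(4) by (simp add: triangulation_labelling_def C_def)
  then have finR: "finite R" using finT bij_betw_finite by blast
  have cell: "aff_dim (C r) = int (m r)" "m r \<le> CARD('n)" "degree (p r) \<le> m r"
    "finite (cell_points b k (C r))"
    "real (card (cell_points b k (C r))) = (-1) ^ m r * poly (p r) (- ((real b - 1) * real b ^ k))"
    if "r \<in> R" for r k
  proof -
    obtain \<pi> s a where r: "r = (\<pi>, s, a)" by (cases r)
    have label: "is_perm \<pi>" "s \<in> open_signs TYPE('n)" "\<forall>i. 0 \<le> a $ i"
      using assms(4) \<open>r \<in> R\<close> unfolding r triangulation_labelling_def by blast+
    have "C r \<in> alcoved_triangulation P"
      using R \<open>r \<in> R\<close> by (rule bij_betwE[THEN bspec])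
    then have "alcoved_simplex \<pi> s a \<noteq> {}"
      by (auto simp: C_def r alcoved_triangulation_def)
    note * = cell_reciprocity[OF label assms(1) this]
    show "aff_dim (C r) = int (m r)" "m r \<le> CARD('n)" "degree (p r) \<le> m r"
      "finite (cell_points b k (C r))"
      "real (card (cell_points b k (C r))) = (-1) ^ m r * poly (p r) (- ((real b - 1) * real b ^ k))"
      using * by (simp_all add: m_def C_def p_def r)
  qed
  \<comment> \<open>Substituting \<open>- (b - 1) * x\<close> into the Ehrhart polynomial of each
    cell turns the cell counts into polynomials in \<open>x = b ^ k\<close>.\<close>
  define q where "q = (\<Sum>r\<in>R. smult ((-1) ^ m r) (pcompose (p r) [: 0, - (real b - 1) :]))"
  have "degree q \<le> CARD('n)"
    unfolding q_def
  proof (rule degree_sum_le[OF finR])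
    fix r assume r: "r \<in> R"
    have "degree (pcompose (p r) [: 0, - (real b - 1) :]) \<le> degree (p r) * 1"
      by (rule order.trans[OF degree_pcompose_le]) (intro mult_left_mono, simp_all)
    also have "\<dots> \<le> CARD('n)"
      using cell(2,3)[OF r] by simp
    finally show "degree (smult ((-1) ^ m r) (pcompose (p r) [: 0, - (real b - 1) :])) \<le> CARD('n)"
      by (rule order.trans[OF degree_smult_le])
  qed
  moreover have "real (tropical_count b (tvec ` P) k) = poly q (real b ^ k)" for k
  proof -
    have fin: "finite (cell_points b k D)" if "D \<in> alcoved_triangulation P" for D
    proof -
      obtain r where "r \<in> R" "D = C r"
        using R \<open>D \<in> alcoved_triangulation P\<close> by (metis bij_betw_imp_surj_on imageE)
      then show ?thesis using cell(4) by blast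
    qed
    have "card (cell_points b k P) = (\<Sum>D\<in>alcoved_triangulation P. card (cell_points b k D))"
      by (rule cell_points_classes[OF closed finT fin])
    then have "tropical_count b (tvec ` P) k = (\<Sum>D\<in>alcoved_triangulation P. card (cell_points b k D))"
      by (simp only: tropical_count_eq[OF assms(1)])
    also have "\<dots> = (\<Sum>r\<in>R. card (cell_points b k (C r)))"
      by (rule sum.reindex_bij_betw[OF R, symmetric])
    finally have "real (tropical_count b (tvec ` P) k) = (\<Sum>r\<in>R. real (card (cell_points b k (C r))))"
      by simp
    also have "\<dots> = (\<Sum>r\<in>R. (-1) ^ m r * poly (p r) (- ((real b - 1) * real b ^ k)))"
      by (rule sum.cong[OF refl]) (rule cell(5))
    also have "\<dots> = poly q (real b ^ k)"
      by (simp add: q_def poly_sum poly_pcompose algebra_simps)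
    finally show ?thesis .
  qed
  ultimately have "tropical_ehrhart_poly b (tvec ` P) = q"
    by (intro tropical_ehrhart_polyI assms(1))
  then have "tropical_ehrhart_coeff b (tvec ` P) i =
      (\<Sum>r\<in>R. (-1) ^ m r * ((- (real b - 1)) ^ i * coeff (p r) i))"
    by (simp add: tropical_ehrhart_coeff_def q_def coeff_sum coeff_pcompose_linear)
  \<comment> \<open>The Ehrhart polynomial of a cell of dimension below \<open>i\<close> has degree
    below \<open>i\<close>, so its coefficient vanishes.\<close>
  also have "\<dots> = (\<Sum>r\<in>{r \<in> R. int i \<le> aff_dim (C r)}. (-1) ^ m r * ((- (real b - 1)) ^ i * coeff (p r) i))"
  proof (rule sum.mono_neutral_right[OF finR])
    show "\<forall>r\<in>R - {r \<in> R. int i \<le> aff_dim (C r)}. (-1) ^ m r * ((- (real b - 1)) ^ i * coeff (p r) i) = 0"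
    proof
      fix r assume r: "r \<in> R - {r \<in> R. int i \<le> aff_dim (C r)}"
      then have "degree (p r) < i"
        using cell(1,3)[of r] by force
      then show "(-1) ^ m r * ((- (real b - 1)) ^ i * coeff (p r) i) = 0"
        by (simp add: coeff_eq_0)
    qed
  qed auto
  also have "\<dots> = (\<Sum>r\<in>{r \<in> R. int i \<le> aff_dim (C r)}. (-1) ^ (m r - i) * (real b - 1) ^ i * coeff (p r) i)"
  proof (rule sum.cong[OF refl])
    fix r assume "r \<in> {r \<in> R. int i \<le> aff_dim (C r)}"
    then have "i \<le> m r" using cell(1)[of r] by simp
    \<comment> \<open>The factor \<open>(-1) ^ i\<close> split off here cancels the one contained in
      \<open>(- (b - 1)) ^ i\<close>.\<close>
    then have "(-1 :: real) ^ m r = (-1) ^ (m r - i) * (-1) ^ i"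
      by (simp flip: power_add)
    then show "(-1) ^ m r * ((- (real b - 1)) ^ i * coeff (p r) i) =
        (-1) ^ (m r - i) * (real b - 1) ^ i * coeff (p r) i"
      unfolding power_minus[of "real b - 1"] by (simp flip: power_mult_distrib)
  qed
  finally show ?thesis
    by (simp add: m_def C_def p_def ehrhart_coeff_def case_prod_unfold)
qed

end
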